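(* Let $S$ be a local set theory in a local language $\mathcal L$ satisfying the Nullstellensatz (for every ground type $\mathbf A$ there is a function symbol of signature $\mathbf 1\to\mathbf A$). Let $f:X\to Y$ be an $S$-function with $X$ of type $\mathbf{PA}$ and $Y$ of type $\mathbf{PB}$, and fix variables $x,y$ of types $\mathbf A,\mathbf B$. Then for all formulae $\vartheta,\gamma$, $\vdash_S(\vartheta\wedge\gamma)^\natural_f=\vartheta^\natural_f\wedge\gamma^\natural_f$ and $\vdash_S(\vartheta\vee\gamma)^\natural_f=\vartheta^\natural_f\vee\gamma^\natural_f$.
   Context: Local languages and local set theories are in the sense of J. L. Bell (Toposes and Local Set Theories), with the standard defined intuitionistic connectives; $\Gamma\vdash_S\alpha$ denotes derivability in $S$. An $S$-set is a closed term of power type; $U_{\mathbf A}=\{x_{\mathbf A}:true\}$. An $S$-function $f:X\to Y$ is a triple $(|f|,X,Y)$ with $\vdash_S|f|\in Y^X$; these form the topos $\mathscr T(S)$ with $\mathit\Omega=U_{\mathbf\Omega}$. $(\langle x_1,\dots,x_n\rangle\mapsto\tau)$ is the $S$-function with graph $\{\langle\langle x_1,\dots,x_n\rangle,\tau\rangle:\langle x_1,\dots,x_n\rangle\in X\}$; $i_X=(x\mapsto x):X\to U_{\mathbf A}$. For $g:Z\to\mathit\Omega$, $g^\natural(z)$ is the formula $\langle z,true\rangle\in|g|$. The preimage translation is $\vartheta^\natural_f:=\big((\langle\bm y\rangle\mapsto\vartheta)\circ(1\times i_Y)\circ(1\times f)\big)^\natural(\langle\bm x\rangle)$, where $\bm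 y=x_1,\dots,x_n,y$ is a list of variables containing the free variables of $\vartheta$ and $y$, and $\bm x=x_1,\dots,x_n,x$. *)

theory Defs
  imports Main
begin

section \<open>Local languages\<close>

text \<open>
  Product types have at least two factors (enforced by \<open>is_type\<close>); the conventions that the
  one-factor product of \<open>A\<close> is \<open>A\<close> and the empty product is the unity type are implemented by
  \<open>prodT\<close>, and correspondingly for tuples by \<open>tuple\<close>.
\<close>

datatype 'g ty =
    One
  | Omega
  | Ground 'g
  | Pow "'g ty"
  | Prod "'g ty list"

fun prodT :: "'g ty list \<Rightarrow> 'g ty" where
  "prodT [] = One"
| "prodT [A] = A"
| "prodT As = Prod As"

text \<open>The sets of ground types and of function symbols may both be empty.\<close>

record ('g, 'f) lang =
  grounds :: "'g set"
  funs :: "'f set"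
  dom_ty :: "'f \<Rightarrow> 'g ty"
  cod_ty :: "'f \<Rightarrow> 'g ty"

inductive is_type :: "('g, 'f, 'm) lang_scheme \<Rightarrow> 'g ty \<Rightarrow> bool" for L where
  "is_type L One"
| "is_type L Omega"
| "g \<in> grounds L \<Longrightarrow> is_type L (Ground g)"
| "is_type L A \<Longrightarrow> is_type L (Pow A)"
| "length As \<ge> 2 \<Longrightarrow> (\<And>A. A \<in> set As \<Longrightarrow> is_type L A) \<Longrightarrow> is_type L (Prod As)"

definition local_language :: "('g, 'f, 'm) lang_scheme \<Rightarrow> bool" where
  "local_language L \<longleftrightarrow> (\<forall>f \<in> funs L. is_type L (dom_ty L f) \<and> is_type L (cod_ty L f))"

definition nullstellensatz :: "('g, 'f, 'm) lang_scheme \<Rightarrow> bool" where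
  "nullstellensatz L \<longleftrightarrow>
     (\<forall>g \<in> grounds L. \<exists>f \<in> funs L. dom_ty L f = One \<and> cod_ty L f = Ground g)"

section \<open>Terms\<close>

text \<open>
  Terms are taken up to renaming of bound variables, in locally nameless form: a free variable
  is a name together with its type, and \<open>Bound k\<close> refers to the \<open>k\<close>-th enclosing \<open>Compr\<close>
  counted from the inside.  The comprehension term \<open>{x : \<alpha>}\<close> is \<open>compr x \<alpha>\<close> below.
  All operations below are meant for terms without dangling \<open>Bound\<close>, which is what being
  well typed in the empty context amounts to; on these, substitution never captures, so
  that the side conditions ``\<open>\<tau>\<close> is free for \<open>x\<close>'' disappear.
\<close>

type_synonym 'g var = "nat \<times> 'g ty"

datatype ('g, 'f) tm =
    Star
  | Var "'g var"
  | Bound nat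
  | App 'f "('g, 'f) tm"
  | Tuple "('g, 'f) tm list"
  | Proj nat "('g, 'f) tm"
  | Compr "'g ty" "('g, 'f) tm"
  | Eq "('g, 'f) tm" "('g, 'f) tm"
  | Mem "('g, 'f) tm" "('g, 'f) tm"

fun tuple :: "('g, 'f) tm list \<Rightarrow> ('g, 'f) tm" where
  "tuple [] = Star"
| "tuple [t] = t"
| "tuple ts = Tuple ts"

abbreviation pair :: "('g, 'f) tm \<Rightarrow> ('g, 'f) tm \<Rightarrow> ('g, 'f) tm" where
  "pair s t \<equiv> Tuple [s, t]"

text \<open>
  \<open>has_type L Bs t A\<close>: \<open>t\<close> is a term of \<open>L\<close> of type \<open>A\<close>, where \<open>Bs\<close> lists the types of
  the dangling bound variables.  Projections are counted from 0.
\<close>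

inductive has_type ::
  "('g, 'f, 'm) lang_scheme \<Rightarrow> 'g ty list \<Rightarrow> ('g, 'f) tm \<Rightarrow> 'g ty \<Rightarrow> bool" for L where
  "has_type L Bs Star One"
| "is_type L (snd x) \<Longrightarrow> has_type L Bs (Var x) (snd x)"
| "k < length Bs \<Longrightarrow> has_type L Bs (Bound k) (Bs ! k)"
| "f \<in> funs L \<Longrightarrow> has_type L Bs t (dom_ty L f) \<Longrightarrow> has_type L Bs (App f t) (cod_ty L f)"
| "length ts \<ge> 2 \<Longrightarrow> list_all2 (has_type L Bs) ts As \<Longrightarrow> has_type L Bs (Tuple ts) (Prod As)"
| "has_type L Bs t (Prod As) \<Longrightarrow> i < length As \<Longrightarrow> has_type L Bs (Proj i t) (As ! i)"
| "is_type L A \<Longrightarrow> has_type L (A # Bs) t Omega \<Longrightarrow> has_type L Bs (Compr A t) (Pow A)"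
| "has_type L Bs s A \<Longrightarrow> has_type L Bs t A \<Longrightarrow> has_type L Bs (Eq s t) Omega"
| "has_type L Bs s A \<Longrightarrow> has_type L Bs t (Pow A) \<Longrightarrow> has_type L Bs (Mem s t) Omega"

abbreviation term_of ::
  "('g, 'f, 'm) lang_scheme \<Rightarrow> ('g, 'f) tm \<Rightarrow> 'g ty \<Rightarrow> bool" where
  "term_of L t A \<equiv> has_type L [] t A"

abbreviation formula :: "('g, 'f, 'm) lang_scheme \<Rightarrow> ('g, 'f) tm \<Rightarrow> bool" where
  "formula L \<alpha> \<equiv> term_of L \<alpha> Omega"

fun fv :: "('g, 'f) tm \<Rightarrow> 'g var set" where
  "fv Star = {}"
| "fv (Var x) = {x}"
| "fv (Bound k) = {}"
| "fv (App f t) = fv t"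
| "fv (Tuple ts) = (\<Union>t \<in> set ts. fv t)"
| "fv (Proj i t) = fv t"
| "fv (Compr A t) = fv t"
| "fv (Eq s t) = fv s \<union> fv t"
| "fv (Mem s t) = fv s \<union> fv t"

text \<open>\<open>subst x s t\<close> is \<open>t(x/s)\<close>.\<close>

fun subst :: "'g var \<Rightarrow> ('g, 'f) tm \<Rightarrow> ('g, 'f) tm \<Rightarrow> ('g, 'f) tm" where
  "subst x s Star = Star"
| "subst x s (Var z) = (if z = x then s else Var z)"
| "subst x s (Bound k) = Bound k"
| "subst x s (App f t) = App f (subst x s t)"
| "subst x s (Tuple ts) = Tuple (map (subst x s) ts)"
| "subst x s (Proj i t) = Proj i (subst x s t)"
| "subst x s (Compr A t) = Compr A (subst x s t)"
| "subst x s (Eq t u) = Eq (subst x s t) (subst x s u)"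
| "subst x s (Mem t u) = Mem (subst x s t) (subst x s u)"

fun abstract_var :: "'g var \<Rightarrow> nat \<Rightarrow> ('g, 'f) tm \<Rightarrow> ('g, 'f) tm" where
  "abstract_var x k Star = Star"
| "abstract_var x k (Var z) = (if z = x then Bound k else Var z)"
| "abstract_var x k (Bound j) = Bound j"
| "abstract_var x k (App f t) = App f (abstract_var x k t)"
| "abstract_var x k (Tuple ts) = Tuple (map (abstract_var x k) ts)"
| "abstract_var x k (Proj i t) = Proj i (abstract_var x k t)"
| "abstract_var x k (Compr A t) = Compr A (abstract_var x (Suc k) t)"
| "abstract_var x k (Eq t u) = Eq (abstract_var x k t) (abstract_var x k u)"
| "abstract_var x k (Mem t u) = Mem (abstract_var x k t) (abstract_var x k u)"

definition compr :: "'g var \<Rightarrow> ('g, 'f) tm \<Rightarrow> ('g, 'f) tm" where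
  "compr x \<alpha> = Compr (snd x) (abstract_var x 0 \<alpha>)"

text \<open>
  A variable of type \<open>A\<close> outside the finite set \<open>V\<close>.  It is only used for variables that get
  bound immediately, so the particular choice does not affect the resulting term.
\<close>

definition fresh_var :: "'g ty \<Rightarrow> 'g var set \<Rightarrow> 'g var" where
  "fresh_var A V = (LEAST n. (n, A) \<notin> V, A)"

section \<open>Defined logical operations\<close>

definition TT :: "('g, 'f) tm" where
  "TT = Eq Star Star"

definition And :: "('g, 'f) tm \<Rightarrow> ('g, 'f) tm \<Rightarrow> ('g, 'f) tm" where
  "And \<alpha> \<beta> = Eq (pair \<alpha> \<beta>) (pair TT TT)"

definition Imp :: "('g, 'f) tm \<Rightarrow> ('g, 'f) tm \<Rightarrow> ('g, 'f) tm" where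
  "Imp \<alpha> \<beta> = Eq (And \<alpha> \<beta>) \<alpha>"

definition Forall :: "'g var \<Rightarrow> ('g, 'f) tm \<Rightarrow> ('g, 'f) tm" where
  "Forall x \<alpha> = Eq (compr x \<alpha>) (compr x TT)"

definition Or :: "('g, 'f) tm \<Rightarrow> ('g, 'f) tm \<Rightarrow> ('g, 'f) tm" where
  "Or \<alpha> \<beta> = (let w = fresh_var Omega (fv \<alpha> \<union> fv \<beta>)
     in Forall w (Imp (And (Imp \<alpha> (Var w)) (Imp \<beta> (Var w))) (Var w)))"

definition Exists :: "'g var \<Rightarrow> ('g, 'f) tm \<Rightarrow> ('g, 'f) tm" where
  "Exists x \<alpha> = (let w = fresh_var Omega (insert x (fv \<alpha>))
     in Forall w (Imp (Forall x (Imp \<alpha> (Var w))) (Var w)))"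

definition Exists1 :: "'g var \<Rightarrow> ('g, 'f) tm \<Rightarrow> ('g, 'f) tm" where
  "Exists1 x \<alpha> = (let x' = fresh_var (snd x) (insert x (fv \<alpha>))
     in Exists x (And \<alpha> (Forall x' (Imp (subst x (Var x') \<alpha>) (Eq (Var x) (Var x'))))))"

fun Conj :: "('g, 'f) tm list \<Rightarrow> ('g, 'f) tm" where
  "Conj [] = TT"
| "Conj [\<alpha>] = \<alpha>"
| "Conj (\<alpha> # \<alpha>s) = And \<alpha> (Conj \<alpha>s)"

section \<open>Local set theories\<close>

definition sequent :: "('g, 'f, 'm) lang_scheme \<Rightarrow> ('g, 'f) tm set \<Rightarrow> ('g, 'f) tm \<Rightarrow> bool" where
  "sequent L \<Gamma> \<alpha> \<longleftrightarrow> finite \<Gamma> \<and> (\<forall>\<gamma> \<in> \<Gamma>. formula L \<gamma>) \<and> formula L \<alpha>"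

inductive derives ::
  "('g, 'f, 'm) lang_scheme \<Rightarrow> (('g, 'f) tm set \<times> ('g, 'f) tm) set \<Rightarrow>
   ('g, 'f) tm set \<Rightarrow> ('g, 'f) tm \<Rightarrow> bool" for L S where
  axiom: "(\<Gamma>, \<alpha>) \<in> S \<Longrightarrow> derives L S \<Gamma> \<alpha>"
| tautology: "formula L \<alpha> \<Longrightarrow> derives L S {\<alpha>} \<alpha>"
| unity: "snd x = One \<Longrightarrow> derives L S {} (Eq (Var x) Star)"
| equality: "is_type L (snd z) \<Longrightarrow> snd x = snd z \<Longrightarrow> snd y = snd z \<Longrightarrow> formula L \<alpha> \<Longrightarrow>
    derives L S {Eq (Var x) (Var y), subst z (Var x) \<alpha>} (subst z (Var y) \<alpha>)"
| proj_tuple: "length xs \<ge> 2 \<Longrightarrow> (\<And>x. x \<in> set xs \<Longrightarrow> is_type L (snd x)) \<Longrightarrow> i < length xs \<Longrightarrow>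
    derives L S {} (Eq (Proj i (Tuple (map Var xs))) (Var (xs ! i)))"
| tuple_proj: "snd x = Prod As \<Longrightarrow> is_type L (Prod As) \<Longrightarrow>
    derives L S {} (Eq (Var x) (Tuple (map (\<lambda>i. Proj i (Var x)) [0..<length As])))"
| comprehension: "is_type L (snd x) \<Longrightarrow> formula L \<alpha> \<Longrightarrow>
    derives L S {} (Eq (Mem (Var x) (compr x \<alpha>)) \<alpha>)"
| thinning: "derives L S \<Gamma> \<alpha> \<Longrightarrow> formula L \<beta> \<Longrightarrow> derives L S (insert \<beta> \<Gamma>) \<alpha>"
| cut: "derives L S \<Gamma> \<alpha> \<Longrightarrow> derives L S (insert \<alpha> \<Gamma>) \<beta> \<Longrightarrow>
    fv \<alpha> \<subseteq> (\<Union>\<gamma> \<in> \<Gamma>. fv \<gamma>) \<union> fv \<beta> \<Longrightarrow> derives L S \<Gamma> \<beta>"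
| substitution: "derives L S \<Gamma> \<alpha> \<Longrightarrow> term_of L \<tau> (snd x) \<Longrightarrow>
    derives L S (subst x \<tau> ` \<Gamma>) (subst x \<tau> \<alpha>)"
| extensionality: "derives L S \<Gamma> (Eq (Mem (Var x) \<sigma>) (Mem (Var x) \<tau>)) \<Longrightarrow>
    x \<notin> (\<Union>\<gamma> \<in> \<Gamma>. fv \<gamma>) \<union> fv \<sigma> \<union> fv \<tau> \<Longrightarrow> derives L S \<Gamma> (Eq \<sigma> \<tau>)"
| equivalence: "derives L S (insert \<alpha> \<Gamma>) \<beta> \<Longrightarrow> derives L S (insert \<beta> \<Gamma>) \<alpha> \<Longrightarrow>
    derives L S \<Gamma> (Eq \<alpha> \<beta>)"

definition local_set_theory ::
  "('g, 'f, 'm) lang_scheme \<Rightarrow> (('g, 'f) tm set \<times> ('g, 'f) tm) set \<Rightarrow> bool" where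
  "local_set_theory L S \<longleftrightarrow>
     (\<forall>(\<Gamma>, \<alpha>) \<in> S. sequent L \<Gamma> \<alpha>) \<and> (\<forall>\<Gamma> \<alpha>. derives L S \<Gamma> \<alpha> \<longrightarrow> (\<Gamma>, \<alpha>) \<in> S)"

section \<open>Sets and functions\<close>

text \<open>\<open>s_set L A X\<close>: \<open>X\<close> is a closed term of type \<open>Pow A\<close>.\<close>

definition s_set :: "('g, 'f, 'm) lang_scheme \<Rightarrow> 'g ty \<Rightarrow> ('g, 'f) tm \<Rightarrow> bool" where
  "s_set L A X \<longleftrightarrow> term_of L X (Pow A) \<and> fv X = {}"

definition univ_set :: "'g ty \<Rightarrow> ('g, 'f) tm" where
  "univ_set A = compr (0, A) TT"

text \<open>
  \<open>compr_tm xs C \<sigma> \<alpha>\<close> is \<open>{\<sigma> : \<alpha>} = {z : \<exists>x\<^sub>1 \<dots> \<exists>x\<^sub>n (z = \<sigma> \<and> \<alpha>)}\<close> for \<open>\<sigma>\<close> of type \<open>C\<close>, with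
  \<open>xs = [x\<^sub>1, \<dots>, x\<^sub>n]\<close> the variables bound by it.
\<close>

definition compr_tm ::
  "'g var list \<Rightarrow> 'g ty \<Rightarrow> ('g, 'f) tm \<Rightarrow> ('g, 'f) tm \<Rightarrow> ('g, 'f) tm" where
  "compr_tm xs C \<sigma> \<alpha> = (let z = fresh_var C (set xs \<union> fv \<sigma> \<union> fv \<alpha>)
     in compr z (foldr Exists xs (And (Eq (Var z) \<sigma>) \<alpha>)))"

definition Subset :: "'g ty \<Rightarrow> ('g, 'f) tm \<Rightarrow> ('g, 'f) tm \<Rightarrow> ('g, 'f) tm" where
  "Subset A X Y = (let x = fresh_var A (fv X \<union> fv Y)
     in Forall x (Imp (Mem (Var x) X) (Mem (Var x) Y)))"

text \<open>
  In the rest of this section the arguments \<open>X\<close>, \<open>Y\<close>, \<open>f\<close>, \<open>g\<close> are closed, so the fixed names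
  used for bound variables cannot clash with anything.
\<close>

text \<open>\<open>prod_set As Xs\<close> is \<open>X\<^sub>1 \<times> \<dots> \<times> X\<^sub>n\<close> with \<open>X\<^sub>i\<close> of type \<open>Pow A\<^sub>i\<close>.\<close>

definition prod_set :: "'g ty list \<Rightarrow> ('g, 'f) tm list \<Rightarrow> ('g, 'f) tm" where
  "prod_set As Xs = (let xs = zip [0..<length As] As
     in compr_tm xs (prodT As) (tuple (map Var xs)) (Conj (map2 (\<lambda>x X. Mem (Var x) X) xs Xs)))"

text \<open>\<open>exp_set A B X Y\<close> is \<open>Y\<^sup>X\<close>.\<close>

definition exp_set :: "'g ty \<Rightarrow> 'g ty \<Rightarrow> ('g, 'f) tm \<Rightarrow> ('g, 'f) tm \<Rightarrow> ('g, 'f) tm" where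
  "exp_set A B X Y = (let u = (0, Pow (Prod [A, B])); x = (1, A); y = (2, B)
     in compr u (And (Subset (Prod [A, B]) (Var u) (prod_set [A, B] [X, Y]))
          (Forall x (Imp (Mem (Var x) X)
            (Exists1 y (And (Mem (Var y) Y) (Mem (pair (Var x) (Var y)) (Var u))))))))"

text \<open>Triples \<open>(|f|, X, Y)\<close>.\<close>

type_synonym ('g, 'f) sfun = "('g, 'f) tm \<times> ('g, 'f) tm \<times> ('g, 'f) tm"

fun sgraph :: "('g, 'f) sfun \<Rightarrow> ('g, 'f) tm" where
  "sgraph (F, X, Y) = F"

fun sdom :: "('g, 'f) sfun \<Rightarrow> ('g, 'f) tm" where
  "sdom (F, X, Y) = X"

fun scod :: "('g, 'f) sfun \<Rightarrow> ('g, 'f) tm" where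
  "scod (F, X, Y) = Y"

definition s_function ::
  "('g, 'f, 'm) lang_scheme \<Rightarrow> (('g, 'f) tm set \<times> ('g, 'f) tm) set \<Rightarrow>
   'g ty \<Rightarrow> 'g ty \<Rightarrow> ('g, 'f) sfun \<Rightarrow> bool" where
  "s_function L S A B f \<longleftrightarrow>
     s_set L A (sdom f) \<and> s_set L B (scod f) \<and> s_set L (Prod [A, B]) (sgraph f) \<and>
     derives L S {} (Mem (sgraph f) (exp_set A B (sdom f) (scod f)))"

text \<open>
  \<open>fun_of_term xs C \<tau> X Y\<close> is \<open>(\<langle>x\<^sub>1, \<dots>, x\<^sub>n\<rangle> \<mapsto> \<tau>) : X \<rightarrow> Y\<close> for \<open>\<tau>\<close> of type \<open>C\<close> with free variables
  among the distinct variables \<open>xs\<close>.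
\<close>

definition fun_of_term ::
  "'g var list \<Rightarrow> 'g ty \<Rightarrow> ('g, 'f) tm \<Rightarrow> ('g, 'f) tm \<Rightarrow> ('g, 'f) tm \<Rightarrow> ('g, 'f) sfun" where
  "fun_of_term xs C \<tau> X Y =
     (compr_tm xs (Prod [prodT (map snd xs), C])
        (pair (tuple (map Var xs)) \<tau>) (Mem (tuple (map Var xs)) X), X, Y)"

definition incl :: "'g ty \<Rightarrow> ('g, 'f) tm \<Rightarrow> ('g, 'f) sfun" where
  "incl A X = fun_of_term [(0, A)] A (Var (0, A)) X (univ_set A)"

text \<open>\<open>g \<circ> f\<close> for \<open>f : X \<rightarrow> Y\<close> and \<open>g : Y \<rightarrow> Z\<close> with \<open>X\<close>, \<open>Y\<close>, \<open>Z\<close> of types \<open>Pow A\<close>, \<open>Pow B\<close>, \<open>Pow C\<close>.\<close>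

definition s_comp ::
  "'g ty \<Rightarrow> 'g ty \<Rightarrow> 'g ty \<Rightarrow> ('g, 'f) sfun \<Rightarrow> ('g, 'f) sfun \<Rightarrow> ('g, 'f) sfun" where
  "s_comp A B C g f = (let x = (0, A); y = (1, B); z = (2, C)
     in (compr_tm [x, z] (Prod [A, C]) (pair (Var x) (Var z))
           (Exists y (And (Mem (pair (Var x) (Var y)) (sgraph f)) (Mem (pair (Var y) (Var z)) (sgraph g)))),
         sdom f, scod g))"

text \<open>
  \<open>one_times Cs A B g\<close> is \<open>1 \<times> g\<close> from \<open>U\<^sub>C\<^sub>1 \<times> \<dots> \<times> U\<^sub>C\<^sub>n \<times> X\<close> to \<open>U\<^sub>C\<^sub>1 \<times> \<dots> \<times> U\<^sub>C\<^sub>n \<times> Y\<close>,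
  for \<open>g : X \<rightarrow> Y\<close> with \<open>X\<close>, \<open>Y\<close> of types \<open>Pow A\<close>, \<open>Pow B\<close>; its graph consists of the pairs of
  \<open>\<langle>u\<^sub>1, \<dots>, u\<^sub>n, x\<rangle>\<close> and \<open>\<langle>u\<^sub>1, \<dots>, u\<^sub>n, y\<rangle>\<close> with \<open>\<langle>x, y\<rangle> \<in> |g|\<close>.
\<close>

definition one_times :: "'g ty list \<Rightarrow> 'g ty \<Rightarrow> 'g ty \<Rightarrow> ('g, 'f) sfun \<Rightarrow> ('g, 'f) sfun" where
  "one_times Cs A B g =
     (let n = length Cs; us = zip [0..<n] Cs; x = (n, A); y = (Suc n, B)
      in (compr_tm (us @ [x, y]) (Prod [prodT (Cs @ [A]), prodT (Cs @ [B])])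
            (pair (tuple (map Var (us @ [x]))) (tuple (map Var (us @ [y]))))
            (Mem (pair (Var x) (Var y)) (sgraph g)),
          prod_set (Cs @ [A]) (map univ_set Cs @ [sdom g]),
          prod_set (Cs @ [B]) (map univ_set Cs @ [scod g])))"

definition natural :: "('g, 'f) sfun \<Rightarrow> ('g, 'f) tm \<Rightarrow> ('g, 'f) tm" where
  "natural g z = Mem (pair z TT) (sgraph g)"

section \<open>Preimage translation\<close>

text \<open>The lists \<open>x\<^sub>1, \<dots>, x\<^sub>n\<close> that may be used, together with \<open>y\<close>, to translate \<open>\<theta>\<close>.\<close>

definition var_context ::
  "('g, 'f, 'm) lang_scheme \<Rightarrow> 'g var list \<Rightarrow> 'g var \<Rightarrow> ('g, 'f) tm \<Rightarrow> bool" where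
  "var_context L xs y \<theta> \<longleftrightarrow> distinct (xs @ [y]) \<and> (\<forall>v \<in> set xs. is_type L (snd v)) \<and>
     fv \<theta> \<subseteq> set (xs @ [y])"

text \<open>\<open>preimage xs x y f \<theta>\<close> is the translation of \<open>\<theta>\<close> along \<open>f\<close>, formed with the lists \<open>xs, y\<close> and \<open>xs, x\<close>.\<close>

definition preimage ::
  "'g var list \<Rightarrow> 'g var \<Rightarrow> 'g var \<Rightarrow> ('g, 'f) sfun \<Rightarrow> ('g, 'f) tm \<Rightarrow> ('g, 'f) tm" where
  "preimage xs x y f \<theta> =
     (let A = snd x; B = snd y; Cs = map snd xs;
          CA = prodT (Cs @ [A]); CB = prodT (Cs @ [B]);
          h = fun_of_term (xs @ [y]) Omega \<theta> (prod_set (Cs @ [B]) (map univ_set Cs @ [univ_set B])) (univ_set Omega)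
      in natural
           (s_comp CA CB Omega (s_comp CB CB Omega h (one_times Cs B B (incl B (scod f))))
              (one_times Cs A B f))
           (tuple (map Var (xs @ [x]))))"

end

theory Submission
  imports Defs
begin

text \<open>
  Unwinding the composites, the translation of \<open>\<theta>\<close> along \<open>f\<close> is provably equivalent to
  \<open>\<exists>v (\<langle>x, v\<rangle> \<in> |f| \<and> \<theta>(y/v))\<close>, whatever list of parameters is used to form it.  The disjunction then
  distributes over the existential quantifier, and the conjunction does because \<open>v\<close> is unique.
  Comparing translations formed with different parameters needs cuts on formulae whose free
  variables do not occur in the conclusion; these are available because the Nullstellensatz
  provides a closed term of every type.
\<close>

section \<open>Simultaneous substitution\<close>

text \<open>The graphs of \<open>incl\<close>, \<open>s_comp\<close>, \<open>one_times\<close> and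
  \<open>fun_of_term\<close> all come from comprehensions {\<sigma> : \<alpha>}, so a single pair of
  introduction and elimination rules, packaged as \<open>describes\<close>, serves all of them. The
  obstacle is that these graphs bind variables with fixed names such as \<open>(0, A)\<close>,
  whereas \<theta>, \<open>x\<close> and the parameter lists are arbitrary: when such a graph is
  eliminated, its bound variables may collide with the context, so they have to be replaced by fresh
  copies. Moreover, the calculus has only single substitutions and a cut rule restricted by a
  condition on variables; simultaneous substitution and unrestricted cut are therefore derived
  beforehand. The factor i_Y demands that the value lie in Y; for values of \<open>f\<close> this
  follows from |f| being contained in X \<times> Y. The existential formula of the overview is never
  written down: \<open>preimage_intro\<close> accepts any term as the value of \<open>f\<close> at
  \<open>x\<close>, and \<open>preimage_elim\<close> supplies a variable for it.\<close>

fun msubst :: "('g var \<Rightarrow> ('g, 'f) tm) \<Rightarrow> ('g, 'f) tm \<Rightarrow> ('g, 'f) tm" where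
  "msubst e Star = Star"
| "msubst e (Var z) = e z"
| "msubst e (Bound k) = Bound k"
| "msubst e (App f t) = App f (msubst e t)"
| "msubst e (Tuple ts) = Tuple (map (msubst e) ts)"
| "msubst e (Proj i t) = Proj i (msubst e t)"
| "msubst e (Compr A t) = Compr A (msubst e t)"
| "msubst e (Eq t u) = Eq (msubst e t) (msubst e u)"
| "msubst e (Mem t u) = Mem (msubst e t) (msubst e u)"

lemma finite_fv [simp]: "finite (fv t)"
  by (induction t) auto

text \<open>The calculus substitutes for one variable at a time. Read as a simultaneous
  substitution, each such step obeys the composition law \<open>msubst_msubst\<close>, which has no
  side conditions.\<close>

lemma subst_eq_msubst: "subst x s t = msubst (Var(x := s)) t"
  by (induction t) auto

lemma msubst_cong: "(\<And>v. v \<in> fv t \<Longrightarrow> e v = e' v) \<Longrightarrow> msubst e t = msubst e' t"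
  by (induction t) auto

lemma msubst_Var [simp]: "msubst Var t = t"
  by (induction t) (auto intro: map_idI)

lemma msubst_ident: "(\<And>v. v \<in> fv t \<Longrightarrow> e v = Var v) \<Longrightarrow> msubst e t = t"
  using msubst_cong[of t e Var] by simp

lemma msubst_closed: "fv t = {} \<Longrightarrow> msubst e t = t"
  by (rule msubst_ident) simp

lemma msubst_msubst: "msubst e (msubst e' t) = msubst (\<lambda>v. msubst e (e' v)) t"
  by (induction t) auto

lemma fv_msubst: "fv (msubst e t) = (\<Union>v \<in> fv t. fv (e v))"
  by (induction t) auto

lemma fv_abstract_var [simp]: "fv (abstract_var x k t) = fv t - {x}"
  by (induction t arbitrary: k) auto

lemma abstract_var_ident: "x \<notin> fv t \<Longrightarrow> abstract_var x k t = t"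
  by (induction t arbitrary: k) (auto intro: map_idI)

text \<open>Substituting commutes with binding \<open>x\<close> only if no inserted term mentions
  \<open>x\<close>; otherwise the abstraction would bind that occurrence too.\<close>

lemma msubst_abstract_var:
  assumes "e x = Var x" "\<And>v. v \<in> fv t \<Longrightarrow> v \<noteq> x \<Longrightarrow> x \<notin> fv (e v)"
  shows "msubst e (abstract_var x k t) = abstract_var x k (msubst e t)"
  using assms
proof (induction t arbitrary: k)
  case (Tuple ts)
  have "msubst e (abstract_var x k t) = abstract_var x k (msubst e t)" if "t \<in> set ts" for t
    using that Tuple.prems by (intro Tuple.IH) auto
  then show ?case by simp
qed (auto simp: abstract_var_ident)

lemma fresh_var:
  assumes "finite V"
  shows "fresh_var A V \<notin> V" "snd (fresh_var A V) = A"
proof -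
  have "finite ((\<lambda>n. (n, A)) -` V)"
    using assms by (intro finite_vimageI) (auto simp: inj_on_def)
  then have "\<exists>n. (n, A) \<notin> V"
    using ex_new_if_finite[OF infinite_UNIV_nat] by (auto simp: vimage_def)
  then show "fresh_var A V \<notin> V"
    unfolding fresh_var_def by (rule LeastI_ex)
qed (simp add: fresh_var_def)

lemma msubst_logic [simp]:
  "msubst e TT = TT"
  "msubst e (And \<alpha> \<beta>) = And (msubst e \<alpha>) (msubst e \<beta>)"
  "msubst e (Imp \<alpha> \<beta>) = Imp (msubst e \<alpha>) (msubst e \<beta>)"
  by (simp_all add: TT_def And_def Imp_def)

lemma abstract_var_logic [simp]:
  "abstract_var x k TT = TT"
  "abstract_var x k (And \<alpha> \<beta>) = And (abstract_var x k \<alpha>) (abstract_var x k \<beta>)"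
  "abstract_var x k (Imp \<alpha> \<beta>) = Imp (abstract_var x k \<alpha>) (abstract_var x k \<beta>)"
  by (simp_all add: TT_def And_def Imp_def)

lemma fv_logic [simp]:
  "fv TT = {}"
  "fv (And \<alpha> \<beta>) = fv \<alpha> \<union> fv \<beta>"
  "fv (Imp \<alpha> \<beta>) = fv \<alpha> \<union> fv \<beta>"
  "fv (compr x \<alpha>) = fv \<alpha> - {x}"
  "fv (Forall x \<alpha>) = fv \<alpha> - {x}"
  by (auto simp: TT_def And_def Imp_def Forall_def compr_def)

text \<open>The name \<open>w\<close> chosen in \<open>Or\<close> depends on the free variables of
  the disjuncts and so changes under substitution. Passing to indices removes the choice, and
  \<open>msubst_Or\<close> becomes a computation.\<close>

lemma Or_nameless:
  "Or \<alpha> \<beta> = Eq (Compr Omega (Imp (And (Imp \<alpha> (Bound 0)) (Imp \<beta> (Bound 0))) (Bound 0))) (Compr Omega TT)"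
  using fresh_var[of "fv \<alpha> \<union> fv \<beta>" Omega]
  by (simp add: Or_def Let_def Forall_def compr_def abstract_var_ident)

text \<open>The choice of \<open>w\<close> disappears as for \<open>Or\<close>. Inside the inner
  comprehension, which binds \<open>x\<close>, the variable \<open>w\<close> has index 1; outside
  it, index 0.\<close>

lemma Exists_nameless:
  "Exists x \<alpha> = Eq (Compr Omega (Imp (Eq (Compr (snd x) (Imp (abstract_var x 0 \<alpha>) (Bound 1)))
     (Compr (snd x) TT)) (Bound 0))) (Compr Omega TT)"
  using fresh_var[of "insert x (fv \<alpha>)" Omega]
  by (auto simp: Exists_def Let_def Forall_def compr_def abstract_var_ident)

lemma fv_Or [simp]: "fv (Or \<alpha> \<beta>) = fv \<alpha> \<union> fv \<beta>"
  by (auto simp: Or_nameless)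

lemma fv_Exists [simp]: "fv (Exists x \<alpha>) = fv \<alpha> - {x}"
  by (auto simp: Exists_nameless)

lemma fv_foldr_Exists [simp]: "fv (foldr Exists xs \<alpha>) = fv \<alpha> - set xs"
  by (induction xs) auto

lemma fv_tuple [simp]: "fv (tuple ts) = (\<Union>t \<in> set ts. fv t)"
  by (cases ts rule: tuple.cases) auto

lemma msubst_tuple [simp]: "msubst e (tuple ts) = tuple (map (msubst e) ts)"
  by (cases ts rule: tuple.cases) auto

lemma msubst_Or [simp]: "msubst e (Or \<alpha> \<beta>) = Or (msubst e \<alpha>) (msubst e \<beta>)"
  by (simp add: Or_nameless)

lemma msubst_Forall:
  assumes "e x = Var x" "\<And>v. v \<in> fv \<alpha> \<Longrightarrow> v \<noteq> x \<Longrightarrow> x \<notin> fv (e v)"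
  shows "msubst e (Forall x \<alpha>) = Forall x (msubst e \<alpha>)"
  using assms by (simp add: Forall_def compr_def msubst_abstract_var)

lemma msubst_Exists:
  assumes "e x = Var x" "\<And>v. v \<in> fv \<alpha> \<Longrightarrow> v \<noteq> x \<Longrightarrow> x \<notin> fv (e v)"
  shows "msubst e (Exists x \<alpha>) = Exists x (msubst e \<alpha>)"
  using assms by (simp add: Exists_nameless msubst_abstract_var)

lemma msubst_foldr_Exists:
  assumes "z \<notin> set xs" "set xs \<inter> fv \<rho> = {}"
  shows "msubst (Var(z := \<rho>)) (foldr Exists xs \<alpha>) = foldr Exists xs (msubst (Var(z := \<rho>)) \<alpha>)"
  using assms by (induction xs) (auto simp: msubst_Exists)

section \<open>Typing\<close>

inductive_cases has_type_VarE: "has_type L Bs (Var x) A"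
inductive_cases has_type_StarE: "has_type L Bs Star A"
inductive_cases has_type_BoundE: "has_type L Bs (Bound k) A"
inductive_cases has_type_AppE: "has_type L Bs (App f t) A"
inductive_cases has_type_TupleE: "has_type L Bs (Tuple ts) A"
inductive_cases has_type_ProjE: "has_type L Bs (Proj i t) A"
inductive_cases has_type_ComprE: "has_type L Bs (Compr C t) A"
inductive_cases has_type_EqE: "has_type L Bs (Eq s t) A"
inductive_cases has_type_MemE: "has_type L Bs (Mem s t) A"
inductive_cases is_type_PowE: "is_type L (Pow A)"
inductive_cases is_type_ProdE: "is_type L (Prod As)"

lemma has_type_Var: "is_type L A \<Longrightarrow> snd x = A \<Longrightarrow> has_type L Bs (Var x) A"
  using has_type.intros(2)[of L x] by simp

text \<open>Variables carry their types and bound indices read theirs off \<open>Bs\<close>, so the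
  syntax determines the type. This allows types to be recovered from a derivable equation or
  membership.\<close>

lemma has_type_unique: "has_type L Bs t A \<Longrightarrow> has_type L Bs t A' \<Longrightarrow> A = A'"
proof (induction arbitrary: A' rule: has_type.induct)
  case (5 ts Bs As)
  from 5(3) obtain As' where "A' = Prod As'" "list_all2 (has_type L Bs) ts As'"
    by (auto elim: has_type_TupleE)
  moreover from 5(2) this have "As = As'"
    by (auto simp: list_all2_conv_all_nth intro!: nth_equalityI)
  ultimately show ?case by simp
next
  case (6 Bs t As i)
  from 6(4) obtain As' where "A' = As' ! i" "has_type L Bs t (Prod As')"
    by (auto elim: has_type_ProjE)
  with "6.IH"[of "Prod As'"] show ?case by simp
qed (erule has_type_VarE has_type_StarE has_type_BoundE has_type_AppE has_type_ComprE
      has_type_EqE has_type_MemE; simp (no_asm_simp))+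

lemma has_type_append: "has_type L Bs t A \<Longrightarrow> has_type L (Bs @ Cs) t A"
proof (induction rule: has_type.induct)
  case (3 k Bs)
  then show ?case using has_type.intros(3)[of k "Bs @ Cs"] by (simp add: nth_append)
next
  case (5 ts Bs As)
  then show ?case by (auto intro!: has_type.intros elim!: list_all2_mono)
qed (auto intro: has_type.intros)

lemma has_type_nil: "term_of L t A \<Longrightarrow> has_type L Bs t A"
  using has_type_append[of L "[]"] by simp

text \<open>The variable being abstracted belongs to the outermost binder, so its type is appended
  at the end of \<open>Bs\<close>, at index \<open>length Bs\<close>. Passing under a
  \<open>Compr\<close> extends \<open>Bs\<close> at the front and raises \<open>k\<close> along with
  it.\<close>

lemma has_type_abstract_var:
  "has_type L Bs t A \<Longrightarrow> k = length Bs \<Longrightarrow> has_type L (Bs @ [snd x]) (abstract_var x k t) A"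
proof (induction arbitrary: k rule: has_type.induct)
  case (2 z Bs)
  then show ?case using has_type.intros(3)[of k "Bs @ [snd x]" L]
    by (auto intro: has_type.intros)
next
  case (3 j Bs)
  then show ?case using has_type.intros(3)[of j "Bs @ [snd x]"] by (simp add: nth_append)
next
  case (5 ts Bs As)
  then show ?case by (auto intro!: has_type.intros simp: list_all2_conv_all_nth)
next
  case (7 A Bs t)
  then show ?case by (auto intro!: has_type.intros)
qed (auto intro: has_type.intros)

text \<open>Only variables whose type belongs to the language are constrained: for the others
  \<open>Var v\<close> is ill typed, and the identity environment \<open>Var\<close> has to
  qualify.\<close>

definition wt_env :: "('g, 'f, 'm) lang_scheme \<Rightarrow> ('g var \<Rightarrow> ('g, 'f) tm) \<Rightarrow> bool" where
  "wt_env L e \<longleftrightarrow> (\<forall>v. is_type L (snd v) \<longrightarrow> term_of L (e v) (snd v))"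

lemma wt_env_Var [simp]: "wt_env L Var"
  by (simp add: wt_env_def has_type.intros del: split_paired_All)

lemma wt_env_upd: "wt_env L e \<Longrightarrow> term_of L t (snd x) \<Longrightarrow> wt_env L (e(x := t))"
  by (auto simp: wt_env_def)

lemma wt_env_rename: "(\<And>v. snd (r v) = snd v) \<Longrightarrow> wt_env L (\<lambda>v. Var (r v))"
  unfolding wt_env_def by (metis has_type.intros(2))

lemma has_type_msubst: "has_type L Bs t A \<Longrightarrow> wt_env L e \<Longrightarrow> has_type L Bs (msubst e t) A"
proof (induction rule: has_type.induct)
  case (2 z Bs)
  then show ?case by (simp add: wt_env_def has_type_nil del: split_paired_All)
next
  case (5 ts Bs As)
  then show ?case by (auto intro!: has_type.intros simp: list_all2_conv_all_nth)
qed (auto intro: has_type.intros)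

lemma is_type_fv: "has_type L Bs t A \<Longrightarrow> v \<in> fv t \<Longrightarrow> is_type L (snd v)"
  by (induction rule: has_type.induct) (auto simp: list_all2_conv_all_nth in_set_conv_nth)

lemma is_type_if_has_type:
  "has_type L Bs t A \<Longrightarrow> local_language L \<Longrightarrow> (\<And>B. B \<in> set Bs \<Longrightarrow> is_type L B) \<Longrightarrow> is_type L A"
proof (induction rule: has_type.induct)
  case (5 ts Bs As)
  then show ?case
    by (intro is_type.intros) (auto simp: list_all2_conv_all_nth in_set_conv_nth)
qed (auto simp: local_language_def intro: is_type.intros elim: is_type_ProdE)

lemma has_type_TT [simp]: "has_type L Bs TT Omega"
  unfolding TT_def by (auto intro: has_type.intros)

lemma has_type_pair: "has_type L Bs s A \<Longrightarrow> has_type L Bs t B \<Longrightarrow> has_type L Bs (pair s t) (Prod [A, B])"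
  by (auto intro!: has_type.intros)

lemma has_type_pairE:
  assumes "has_type L Bs (pair s t) (Prod [A, B])"
  shows "has_type L Bs s A" "has_type L Bs t B"
  using assms by (auto elim: has_type_TupleE)

lemma has_type_And: "has_type L Bs \<alpha> Omega \<Longrightarrow> has_type L Bs \<beta> Omega \<Longrightarrow> has_type L Bs (And \<alpha> \<beta>) Omega"
  unfolding And_def by (rule has_type.intros(8)[of _ _ _ "Prod [Omega, Omega]"]) (auto intro!: has_type_pair)

lemma has_type_Imp: "has_type L Bs \<alpha> Omega \<Longrightarrow> has_type L Bs \<beta> Omega \<Longrightarrow> has_type L Bs (Imp \<alpha> \<beta>) Omega"
  unfolding Imp_def by (auto intro!: has_type_And intro: has_type.intros)

lemma has_type_Or: "formula L \<alpha> \<Longrightarrow> formula L \<beta> \<Longrightarrow> formula L (Or \<alpha> \<beta>)"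
  unfolding Or_nameless
  using has_type.intros(3)[of 0 "[Omega]" L]
  by (auto intro!: has_type.intros(8)[of _ _ _ "Pow Omega"] has_type.intros(7) is_type.intros
      has_type_Imp has_type_And intro: has_type_nil)

lemma has_type_compr:
  "is_type L (snd x) \<Longrightarrow> formula L \<alpha> \<Longrightarrow> term_of L (compr x \<alpha>) (Pow (snd x))"
  unfolding compr_def using has_type_abstract_var[of L "[]" \<alpha> Omega 0 x]
  by (auto intro: has_type.intros)

lemma has_type_Forall: "is_type L (snd x) \<Longrightarrow> formula L \<alpha> \<Longrightarrow> formula L (Forall x \<alpha>)"
  unfolding Forall_def by (auto intro!: has_type.intros(8)[of _ _ _ "Pow (snd x)"] has_type_compr)

lemma has_type_Exists: "is_type L (snd x) \<Longrightarrow> formula L \<alpha> \<Longrightarrow> formula L (Exists x \<alpha>)"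
  unfolding Exists_def Let_def using fresh_var[of "insert x (fv \<alpha>)" Omega]
  by (auto intro!: has_type_Forall has_type_Imp is_type.intros)
     (metis has_type.intros(2) is_type.intros(2))+

lemma has_type_foldr_Exists:
  "(\<And>v. v \<in> set xs \<Longrightarrow> is_type L (snd v)) \<Longrightarrow> formula L \<alpha> \<Longrightarrow> formula L (foldr Exists xs \<alpha>)"
  by (induction xs) (auto intro: has_type_Exists)

lemma has_type_tuple: "list_all2 (has_type L Bs) ts As \<Longrightarrow> has_type L Bs (tuple ts) (prodT As)"
  by (cases ts rule: tuple.cases; cases As rule: prodT.cases) (auto intro!: has_type.intros)

text \<open>At ground types the Nullstellensatz supplies \<open>App f Star\<close>;
  \<open>Star\<close>, \<open>TT\<close>, a comprehension and tuples of closed terms handle the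
  remaining types.\<close>

lemma closed_term_exists:
  assumes "nullstellensatz L" "is_type L A"
  shows "\<exists>t. term_of L t A \<and> fv t = {}"
  using assms(2)
proof (induction rule: is_type.induct)
  case 1
  show ?case by (auto intro!: exI[of _ Star] has_type.intros)
next
  case 2
  show ?case by (auto intro!: exI[of _ TT])
next
  case (3 g)
  with assms(1) obtain f where f: "f \<in> funs L" "dom_ty L f = One" "cod_ty L f = Ground g"
    by (auto simp: nullstellensatz_def)
  then show ?case
    using has_type.intros(4)[of f L "[]" Star] by (auto intro!: exI[of _ "App f Star"] has_type.intros(1))
next
  case (4 A)
  then show ?case by (auto intro!: exI[of _ "compr (0, A) TT"] has_type_compr[of L "(0, A)", simplified])
next
  case (5 As)
  from 5(3) obtain c where c: "\<And>A. A \<in> set As \<Longrightarrow> term_of L (c A) A \<and> fv (c A) = {}"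
    by metis
  with 5(1) show ?case
    by (auto intro!: exI[of _ "Tuple (map c As)"] has_type.intros simp: list_all2_conv_all_nth)
qed

definition env_of :: "'g var list \<Rightarrow> ('g, 'f) tm list \<Rightarrow> 'g var \<Rightarrow> ('g, 'f) tm" where
  "env_of vs ts v = (case map_of (zip vs ts) v of Some t \<Rightarrow> t | None \<Rightarrow> Var v)"

lemma env_of_nth:
  "distinct vs \<Longrightarrow> length vs = length ts \<Longrightarrow> i < length ts \<Longrightarrow> env_of vs ts (vs ! i) = ts ! i"
  by (simp add: env_of_def map_of_zip_nth)

lemma map_env_of: "distinct vs \<Longrightarrow> length vs = length ts \<Longrightarrow> map (env_of vs ts) vs = ts"
  by (auto intro!: nth_equalityI simp: env_of_nth)

lemma wt_env_env_of:
  assumes "list_all2 (term_of L) ts (map snd vs)"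
  shows "wt_env L (env_of vs ts)"
  unfolding wt_env_def
proof (intro allI impI)
  fix v :: "'a var"
  assume v: "is_type L (snd v)"
  show "term_of L (env_of vs ts v) (snd v)"
  proof (cases "map_of (zip vs ts) v")
    case None
    with v show ?thesis by (simp add: env_of_def has_type.intros)
  next
    case (Some t)
    then have "(v, t) \<in> set (zip vs ts)" by (rule map_of_SomeD)
    with assms Some show ?thesis
      by (auto simp: env_of_def list_all2_conv_all_nth set_zip)
  qed
qed

lemma wt_env_list:
  "wt_env L e \<Longrightarrow> \<forall>v \<in> set vs. is_type L (snd v) \<Longrightarrow> list_all2 (term_of L) (map e vs) (map snd vs)"
  by (simp add: wt_env_def list_all2_conv_all_nth del: split_paired_All)

text \<open>Fresh copies of variables are made by adding such a bound to their names, which keeps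
  types and is easily inverted.\<close>

lemma fst_bound: "finite V \<Longrightarrow> \<exists>N::nat. \<forall>v \<in> V. fst v < N"
  using finite_nat_set_iff_bounded[of "fst ` V"] by simp

section \<open>Natural deduction\<close>

locale lst =
  fixes L :: "('g, 'f, 'm) lang_scheme"
    and S :: "(('g, 'f) tm set \<times> ('g, 'f) tm) set"
  assumes local_language: "local_language L"
    and local_set_theory: "local_set_theory L S"
    and nullstellensatz: "nullstellensatz L"
begin

abbreviation derivable :: "('g, 'f) tm set \<Rightarrow> ('g, 'f) tm \<Rightarrow> bool" (infix "\<turnstile>" 50) where
  "\<Gamma> \<turnstile> \<alpha> \<equiv> derives L S \<Gamma> \<alpha>"

definition ctx :: "('g, 'f) tm set \<Rightarrow> bool" where
  "ctx \<Gamma> \<longleftrightarrow> finite \<Gamma> \<and> (\<forall>\<gamma> \<in> \<Gamma>. formula L \<gamma>)"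

lemma ctx_simps [simp]:
  "ctx {}"
  "ctx (insert \<alpha> \<Gamma>) \<longleftrightarrow> formula L \<alpha> \<and> ctx \<Gamma>"
  "ctx (\<Gamma> \<union> \<Delta>) \<longleftrightarrow> ctx \<Gamma> \<and> ctx \<Delta>"
  by (auto simp: ctx_def)

lemma is_type: "term_of L t A \<Longrightarrow> is_type L A"
  using is_type_if_has_type local_language by fastforce

text \<open>Rules such as cut, extensionality and equivalence carry no typing premises; the typings
  are recovered by induction, with \<open>local_set_theory\<close> accounting for the axioms. Later
  proofs draw nearly all their typing facts from here.\<close>

lemma derives_wf:
  assumes "\<Gamma> \<turnstile> \<alpha>"
  shows "ctx \<Gamma>" "formula L \<alpha>"
proof -
  have "ctx \<Gamma> \<and> formula L \<alpha>"
    using assms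
  proof (induction rule: derives.induct)
    case (axiom \<Gamma> \<alpha>)
    then show ?case using local_set_theory
      by (auto simp: local_set_theory_def sequent_def ctx_def)
  next
    case (unity x)
    then show ?case
      by (metis ctx_simps(1) has_type.intros(1,2,8) is_type.intros(1))
  next
    case (equality z x y \<alpha>)
    then have "wt_env L (Var(z := Var x))" "wt_env L (Var(z := Var y))"
      by (metis has_type.intros(2) wt_env_Var wt_env_upd)+
    with equality show ?case
      by (auto simp: subst_eq_msubst intro!: has_type_msubst)
        (metis has_type.intros(2) has_type.intros(8))
  next
    case (proj_tuple xs i)
    have "term_of L (Tuple (map Var xs)) (Prod (map snd xs))"
      using proj_tuple(1) by (intro has_type.intros) (auto simp: list_all2_conv_all_nth intro!: has_type_Var proj_tuple(2))
    from has_type.intros(6)[OF this, of i] proj_tuple show ?case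
      by (auto intro!: has_type.intros(8)[of _ _ _ "snd (xs ! i)"] has_type_Var proj_tuple(2))
  next
    case (tuple_proj x As)
    have "term_of L (Var x) (Prod As)"
      using tuple_proj has_type.intros(2)[of L x] by simp
    then show ?case using tuple_proj(2)
      by (auto intro!: has_type.intros simp: list_all2_conv_all_nth elim: is_type_ProdE)
  next
    case (comprehension x \<alpha>)
    then show ?case
      by (auto intro!: has_type.intros(8)[of _ _ _ Omega] has_type.intros(9)[of _ _ _ "snd x"]
          intro: has_type_compr has_type.intros)
  next
    case (substitution \<Gamma> \<alpha> \<tau> x)
    then have "wt_env L (Var(x := \<tau>))" by (simp add: wt_env_upd)
    with substitution show ?case
      by (auto simp: ctx_def subst_eq_msubst intro: has_type_msubst)
  next
    case (extensionality \<Gamma> x \<sigma> \<tau>)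
    then obtain A B where "term_of L (Var x) A" "term_of L \<sigma> (Pow A)"
      "term_of L (Var x) B" "term_of L \<tau> (Pow B)"
      by (auto elim!: has_type_EqE has_type_MemE)
    moreover from this have "A = B" using has_type_unique by blast
    ultimately show ?case using extensionality by (auto intro: has_type.intros)
  next
    case (equivalence \<alpha> \<Gamma> \<beta>)
    then show ?case by (auto intro: has_type.intros)
  qed (auto)
  then show "ctx \<Gamma>" "formula L \<alpha>" by auto
qed

section \<open>Structural rules: thinning, simultaneous substitution, cut\<close>

lemma weaken: "\<Gamma> \<turnstile> \<alpha> \<Longrightarrow> \<Gamma> \<subseteq> \<Delta> \<Longrightarrow> ctx \<Delta> \<Longrightarrow> \<Delta> \<turnstile> \<alpha>"
proof -
  assume *: "\<Gamma> \<turnstile> \<alpha>" "\<Gamma> \<subseteq> \<Delta>" "ctx \<Delta>"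
  have "\<Theta> \<union> \<Gamma> \<turnstile> \<alpha>" if "finite \<Theta>" "\<Theta> \<subseteq> \<Delta>" for \<Theta>
    using that by (induction \<Theta> rule: finite_induct) (use * in \<open>auto simp: ctx_def intro: thinning\<close>)
  from this[of \<Delta>] * show ?thesis by (auto simp: ctx_def Un_absorb2)
qed

lemma assumption: "\<alpha> \<in> \<Gamma> \<Longrightarrow> ctx \<Gamma> \<Longrightarrow> \<Gamma> \<turnstile> \<alpha>"
  by (rule weaken[OF tautology]) (auto simp: ctx_def)

text \<open>If no inserted term contains a variable of \<open>D\<close>, a later single substitution
  cannot touch what an earlier one inserted. Carried out one after the other, the single
  substitutions then amount to the simultaneous one.\<close>

lemma derives_msubst_disjoint:
  assumes "finite D" "\<Gamma> \<turnstile> \<alpha>" "wt_env L e"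
    and "\<And>v. v \<in> D \<Longrightarrow> is_type L (snd v)"
    and "\<And>v. v \<in> D \<Longrightarrow> fv (e v) \<inter> D = {}"
    and "\<And>v. v \<notin> D \<Longrightarrow> e v = Var v"
  shows "msubst e ` \<Gamma> \<turnstile> msubst e \<alpha>"
  using assms
proof (induction D arbitrary: e rule: finite_induct)
  case empty
  then have "e = Var" by blast
  with empty show ?case by simp
next
  case (insert v D)
  let ?e = "e(v := Var v)"
  have "term_of L (Var v) (snd v)" by (rule has_type_Var[OF insert.prems(3)]) simp_all
  with insert have IH: "msubst ?e ` \<Gamma> \<turnstile> msubst ?e \<alpha>"
    by (intro insert.IH wt_env_upd) auto
  have ev: "term_of L (e v) (snd v)"
    using insert.prems(2,3) unfolding wt_env_def by blast
  have "msubst (Var(v := e v)) (?e u) = e u" for u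
    using insert.prems(4)[of u] insert.prems(5)[of u] by (cases "u \<in> insert v D") (auto intro!: msubst_ident)
  then have "subst v (e v) (msubst ?e t) = msubst e t" for t
    by (simp only: subst_eq_msubst msubst_msubst)
  with substitution[OF IH ev] show ?case by (simp add: image_image)
qed

text \<open>The variables are first renamed apart, so that single substitutions can be done in turn.\<close>

lemma derives_msubst:
  assumes der: "\<Gamma> \<turnstile> \<alpha>" and e: "wt_env L e"
  shows "msubst e ` \<Gamma> \<turnstile> msubst e \<alpha>"
proof -
  define D where "D = fv \<alpha> \<union> (\<Union>\<gamma> \<in> \<Gamma>. fv \<gamma>)"
  have fin: "finite D" using derives_wf(1)[OF der] by (auto simp: D_def ctx_def)
  have ty: "is_type L (snd v)" if "v \<in> D" for v
    using that derives_wf[OF der] is_type_fv unfolding D_def ctx_def by blast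
  have "finite (D \<union> (\<Union>v \<in> D. fv (e v)))" using fin by simp
  from fst_bound[OF this] obtain N where N: "\<forall>v \<in> D \<union> (\<Union>v \<in> D. fv (e v)). fst v < N" ..
  \<comment> \<open>\<open>N\<close> exceeds the names in \<open>D\<close> and in the terms that
    \<open>e\<close> puts there, so the copies \<open>r v\<close> avoid both. This makes both stages
    instances of the disjoint case: \<open>e1\<close> moves \<open>D\<close> to its copies, and
    \<open>e2\<close> replaces each copy by the intended term, recovering the original name by
    subtracting \<open>N\<close>.\<close>
  define r where "r = (\<lambda>v::'g var. (fst v + N, snd v))"
  have r_D: "r v \<notin> D" "r v \<notin> fv (e u)" if "u \<in> D" for v u
    using bspec[OF N, of "r v"] that by (auto simp: r_def)
  have r_ty: "snd (r v) = snd v" for v by (simp add: r_def)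
  define e1 where "e1 = (\<lambda>v. if v \<in> D then Var (r v) else Var v :: ('g, 'f) tm)"
  define e2 where "e2 = (\<lambda>v. if v \<in> r ` D then e (fst v - N, snd v) else Var v)"
  have wt1: "wt_env L e1"
    using wt_env_rename[of "\<lambda>v. if v \<in> D then r v else v" L]
    by (simp add: e1_def r_ty if_distrib[of Var] cong: if_cong)
  have wt2: "wt_env L e2"
    using e by (auto simp: e2_def wt_env_def r_ty intro: has_type.intros) (auto simp: r_def intro: has_type.intros(2)[where x = "(_, _)", simplified])
  have "msubst e1 ` \<Gamma> \<turnstile> msubst e1 \<alpha>"
    using r_D by (intro derives_msubst_disjoint[OF fin der wt1 ty]) (auto simp: e1_def)
  then have "msubst e2 ` msubst e1 ` \<Gamma> \<turnstile> msubst e2 (msubst e1 \<alpha>)"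
  proof (rule derives_msubst_disjoint[of "r ` D", rotated])
    show "fv (e2 v) \<inter> r ` D = {}" if "v \<in> r ` D" for v
      using that r_D by (auto simp: e2_def) (auto simp: r_def)
  qed (use fin wt2 ty r_ty in \<open>auto simp: e2_def\<close>)
  moreover have "msubst e2 (msubst e1 t) = msubst e t" if "fv t \<subseteq> D" for t
    unfolding msubst_msubst
    by (rule msubst_cong) (use that in \<open>auto simp: e1_def e2_def r_def\<close>)
  ultimately show ?thesis by (simp add: D_def image_image UN_upper le_supI2 cong: image_cong)
qed

lemma derives_msubst_term:
  assumes "\<Gamma> \<turnstile> \<alpha>" "term_of L \<tau> (snd x)"
  shows "msubst (Var(x := \<tau>)) ` \<Gamma> \<turnstile> msubst (Var(x := \<tau>)) \<alpha>"
  using assms by (intro derives_msubst wt_env_upd) auto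

text \<open>The variables of the cut formula that occur nowhere else are instantiated with closed terms.\<close>

lemma cut_formula:
  assumes "\<Gamma> \<turnstile> \<alpha>" "insert \<alpha> \<Gamma> \<turnstile> \<beta>"
  shows "\<Gamma> \<turnstile> \<beta>"
proof -
  define V where "V = (\<Union>\<gamma> \<in> \<Gamma>. fv \<gamma>) \<union> fv \<beta>"
  obtain c where c: "\<And>A. is_type L A \<Longrightarrow> term_of L (c A) A \<and> fv (c A) = {}"
    using closed_term_exists[OF nullstellensatz] by metis
  define e where "e = (\<lambda>v. if v \<in> V then Var v else c (snd v))"
  have e: "wt_env L e"
    unfolding wt_env_def e_def using c has_type.intros(2) by auto
  have id: "msubst e t = t" if "fv t \<subseteq> V" for t
    by (rule msubst_ident) (use that in \<open>auto simp: e_def\<close>)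
  then have "msubst e ` \<Gamma> = \<Gamma>" "msubst e \<beta> = \<beta>"
    by (auto simp: V_def image_iff UN_upper le_supI1)
  \<comment> \<open>As \<open>e\<close> fixes the variables of \<Gamma> and \<beta>, the
    instantiation of both premises alters only the cut formula, whose remaining variables then
    satisfy the side condition of \<open>cut\<close>.\<close>
  with derives_msubst[OF assms(1) e] derives_msubst[OF assms(2) e]
  have "\<Gamma> \<turnstile> msubst e \<alpha>" "insert (msubst e \<alpha>) \<Gamma> \<turnstile> \<beta>" by simp_all
  moreover have "fv (msubst e \<alpha>) \<subseteq> V"
  proof -
    have "fv (e v) \<subseteq> V" if "v \<in> fv \<alpha>" for v
      using c[OF is_type_fv[OF derives_wf(2)[OF assms(1)] that]] by (simp add: e_def)
    then show ?thesis by (auto simp: fv_msubst)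
  qed
  ultimately show ?thesis unfolding V_def by (rule cut)
qed

text \<open>The hypotheses in \<Gamma> are cut away one at a time while \<Delta> stays in the
  context; this works because \<Gamma> is finite.\<close>

lemma cut_set:
  assumes "\<Gamma> \<turnstile> \<alpha>" "\<And>\<gamma>. \<gamma> \<in> \<Gamma> \<Longrightarrow> \<Delta> \<turnstile> \<gamma>" "ctx \<Delta>"
  shows "\<Delta> \<turnstile> \<alpha>"
proof -
  have "finite \<Gamma>" using derives_wf(1)[OF assms(1)] by (simp add: ctx_def)
  have "\<Delta> \<turnstile> \<alpha>" if "\<Theta> \<subseteq> \<Gamma>" "\<Theta> \<union> \<Delta> \<turnstile> \<alpha>" "finite \<Theta>" for \<Theta>
    using that(3,1,2)
  proof (induction \<Theta> rule: finite_induct)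
    case (insert \<theta> \<Theta>)
    have "\<Theta> \<union> \<Delta> \<turnstile> \<theta>"
      using insert.prems assms(2)[of \<theta>] derives_wf(1)[OF insert.prems(2)] by (auto intro: weaken)
    with insert show ?case by (auto intro: cut_formula)
  qed simp
  moreover have "\<Gamma> \<union> \<Delta> \<turnstile> \<alpha>"
    using assms derives_wf(1)[OF assms(1)] by (auto intro: weaken)
  ultimately show ?thesis using \<open>finite \<Gamma>\<close> by blast
qed

lemma cut1: "{\<alpha>} \<turnstile> \<beta> \<Longrightarrow> \<Gamma> \<turnstile> \<alpha> \<Longrightarrow> \<Gamma> \<turnstile> \<beta>"
  by (rule cut_set) (auto dest: derives_wf)

lemma cut2: "{\<alpha>, \<beta>} \<turnstile> \<delta> \<Longrightarrow> \<Gamma> \<turnstile> \<alpha> \<Longrightarrow> \<Gamma> \<turnstile> \<beta> \<Longrightarrow> \<Gamma> \<turnstile> \<delta>"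
  by (rule cut_set[of "{\<alpha>, \<beta>}"]) (auto dest: derives_wf)

lemma weaken0: "{} \<turnstile> \<alpha> \<Longrightarrow> ctx \<Gamma> \<Longrightarrow> \<Gamma> \<turnstile> \<alpha>"
  by (rule weaken) auto

lemma insert_cong_left:
  assumes "insert \<alpha> \<Gamma> \<turnstile> \<delta>" "insert \<beta> \<Gamma> \<turnstile> \<alpha>"
  shows "insert \<beta> \<Gamma> \<turnstile> \<delta>"
proof (rule cut_formula[OF assms(2)])
  show "insert \<alpha> (insert \<beta> \<Gamma>) \<turnstile> \<delta>"
    using derives_wf(1)[OF assms(1)] derives_wf(1)[OF assms(2)] by (auto intro: weaken[OF assms(1)])
qed

subsection \<open>Equality\<close>

lemma eq_type:
  assumes "\<Gamma> \<turnstile> Eq s t" "term_of L s A"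
  shows "term_of L t A"
  using derives_wf(2)[OF assms(1)] has_type_unique[OF assms(2)] by (auto elim!: has_type_EqE)

text \<open>The equality axiom speaks of variables only. It is applied to fresh variables
  \<open>u\<close> and \<open>w\<close>, which are then replaced by \<open>s\<close> and
  \<open>t\<close> while \<open>e\<close> instantiates the rest. Thanks to \<open>e\<close>, the
  formula \<alpha> can serve as a template with several holes of which only \<open>z\<close>
  changes.\<close>

lemma leibniz:
  assumes eq: "\<Gamma> \<turnstile> Eq s t" and s: "term_of L s (snd z)" and \<alpha>: "formula L \<alpha>" and e: "wt_env L e"
    and der: "\<Gamma> \<turnstile> msubst (e(z := s)) \<alpha>"
  shows "\<Gamma> \<turnstile> msubst (e(z := t)) \<alpha>"
proof -
  define u where "u = fresh_var (snd z) (insert z (fv \<alpha>))"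
  define w where "w = fresh_var (snd z) (insert u (insert z (fv \<alpha>)))"
  have uw: "u \<notin> insert z (fv \<alpha>)" "w \<notin> insert u (insert z (fv \<alpha>))" "snd u = snd z" "snd w = snd z"
    unfolding u_def w_def by (rule fresh_var; simp)+
  let ?E = "e(u := s, w := t)"
  have t: "term_of L t (snd z)" by (rule eq_type[OF eq s])
  have "{Eq (Var u) (Var w), subst z (Var u) \<alpha>} \<turnstile> subst z (Var w) \<alpha>"
    using uw is_type[OF s] \<alpha> by (intro equality) auto
  moreover have "wt_env L ?E" using e s t uw by (intro wt_env_upd) simp_all
  ultimately have "msubst ?E ` {Eq (Var u) (Var w), subst z (Var u) \<alpha>} \<turnstile> msubst ?E (subst z (Var w) \<alpha>)"
    by (rule derives_msubst)
  moreover have "msubst ?E (subst z (Var u) \<alpha>) = msubst (e(z := s)) \<alpha>"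
    "msubst ?E (subst z (Var w) \<alpha>) = msubst (e(z := t)) \<alpha>"
    unfolding subst_eq_msubst msubst_msubst by (rule msubst_cong; use uw in auto)+
  moreover have "u \<noteq> w" using uw by auto
  ultimately have "{Eq s t, msubst (e(z := s)) \<alpha>} \<turnstile> msubst (e(z := t)) \<alpha>"
    by simp
  from cut2[OF this eq der] show ?thesis .
qed

text \<open>The holes are rewritten one variable at a time; the intermediate environment already
  follows \<open>e'\<close> on \<open>D\<close> and still follows \<open>e\<close>
  elsewhere.\<close>

lemma leibniz_env:
  assumes eq: "\<And>v. v \<in> fv \<alpha> \<Longrightarrow> \<Gamma> \<turnstile> Eq (e v) (e' v)"
    and e: "wt_env L e" and e': "wt_env L e'" and der: "\<Gamma> \<turnstile> msubst e \<alpha>" and \<alpha>: "formula L \<alpha>"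
  shows "\<Gamma> \<turnstile> msubst e' \<alpha>"
proof -
  have "\<Gamma> \<turnstile> msubst (\<lambda>v. if v \<in> D then e' v else e v) \<alpha>" if "finite D" "D \<subseteq> fv \<alpha>" for D
    using that
  proof (induction D rule: finite_induct)
    case empty
    with der show ?case by simp
  next
    case (insert z D)
    let ?e = "\<lambda>v. if v \<in> D then e' v else e v"
    have z: "is_type L (snd z)" using insert.prems \<alpha> is_type_fv by blast
    have "wt_env L ?e" using e e' by (simp add: wt_env_def del: split_paired_All)
    moreover have "?e(z := e z) = ?e" using insert.hyps by auto
    moreover have "?e(z := e' z) = (\<lambda>v. if v \<in> insert z D then e' v else e v)" by auto
    moreover have "term_of L (e z) (snd z)" using e z unfolding wt_env_def by blast
    ultimately show ?case
      using leibniz[OF eq[of z] _ \<alpha>, of z ?e] insert by simp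
  qed
  from this[of "fv \<alpha>"] show ?thesis by (simp cong: msubst_cong)
qed

text \<open>Reflexivity is not among the rules. If p is the first projection of the pair of a
  variable x with itself, then p = x is an axiom; rewriting the left side of this equation by the
  equation itself gives x = x.\<close>

lemma Eq_refl:
  assumes t: "term_of L t A" and "ctx \<Gamma>"
  shows "\<Gamma> \<turnstile> Eq t t"
proof -
  let ?x = "(0, A)"
  have A: "is_type L A" by (rule is_type[OF t])
  have pr: "{} \<turnstile> Eq (Proj 0 (pair (Var ?x) (Var ?x))) (Var ?x)"
    using proj_tuple[of "[?x, ?x]" L 0 S] A by simp
  have x: "term_of L (Var ?x) A" using A has_type.intros(2)[of L ?x] by simp
  have "formula L (Eq (Var (1, A)) (Var ?x))"
    using x A has_type.intros(2)[of L "(1, A)"] by (auto intro: has_type.intros)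
  from leibniz[OF pr _ this, of "(1, A)" Var]
  have "{} \<turnstile> Eq (Var ?x) (Var ?x)"
    using pr has_type.intros(6)[OF has_type_pair[OF x x], of 0] by simp
  from derives_msubst_term[OF this, of t ?x] t have "{} \<turnstile> Eq t t" by simp
  then show ?thesis using assms(2) by (rule weaken0)
qed

lemma Eq_sym:
  assumes "\<Gamma> \<turnstile> Eq s t"
  shows "\<Gamma> \<turnstile> Eq t s"
proof -
  from derives_wf(2)[OF assms] obtain A where A: "term_of L s A" by (auto elim: has_type_EqE)
  have "formula L (Eq (Var (1, A)) (Var (0, A)))"
    using is_type[OF A] has_type.intros(2)[of L "(1, A)"] has_type.intros(2)[of L "(0, A)"]
    by (auto intro: has_type.intros)
  from leibniz[OF assms _ this, of "(1, A)" "Var((0, A) := s)"] A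
  show ?thesis using Eq_refl[OF A derives_wf(1)[OF assms]] by (simp add: wt_env_upd)
qed

lemma Eq_trans:
  assumes "\<Gamma> \<turnstile> Eq s t" "\<Gamma> \<turnstile> Eq t u"
  shows "\<Gamma> \<turnstile> Eq s u"
proof -
  from derives_wf(2)[OF assms(1)] obtain A where A: "term_of L s A" "term_of L t A"
    by (auto elim: has_type_EqE)
  have "formula L (Eq (Var (0, A)) (Var (1, A)))"
    using is_type[OF A(1)] has_type.intros(2)[of L "(1, A)"] has_type.intros(2)[of L "(0, A)"]
    by (auto intro: has_type.intros)
  from leibniz[OF assms(2) _ this, of "(1, A)" "Var((0, A) := s)"] A assms(1)
  show ?thesis by (simp add: wt_env_upd)
qed

lemma Eq_mp:
  assumes "\<Gamma> \<turnstile> Eq \<alpha> \<beta>" "\<Gamma> \<turnstile> \<alpha>"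
  shows "\<Gamma> \<turnstile> \<beta>"
proof -
  have "formula L (Var (0, Omega))"
    using has_type.intros(2)[of L "(0, Omega)"] by (auto intro: is_type.intros)
  from leibniz[OF assms(1) _ this, of "(0, Omega)" Var] derives_wf(2)[OF assms(2)] assms(2)
  show ?thesis by simp
qed

lemma Mem_cong:
  assumes "\<Gamma> \<turnstile> Eq s t" "\<Gamma> \<turnstile> Eq X Y" "\<Gamma> \<turnstile> Mem s X"
  shows "\<Gamma> \<turnstile> Mem t Y"
proof -
  from derives_wf(2)[OF assms(3)] obtain A where A: "term_of L s A" "term_of L X (Pow A)"
    by (auto elim: has_type_MemE)
  have t: "term_of L t A" "term_of L Y (Pow A)" using A assms(1,2) eq_type by blast+
  let ?v = "(0, A)" and ?w = "(1, Pow A)"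
  have \<alpha>: "formula L (Mem (Var ?v) (Var ?w))"
    using is_type[OF A(1)] is_type[OF A(2)] has_type.intros(2)[of L ?v] has_type.intros(2)[of L ?w]
    by (auto intro: has_type.intros)
  from leibniz[OF assms(1) _ \<alpha>, of ?v "Var(?w := X)"] A assms(3) have "\<Gamma> \<turnstile> Mem t X"
    by (simp add: wt_env_upd)
  with leibniz[OF assms(2) _ \<alpha>, of ?w "Var(?v := t)"] A t show ?thesis
    by (simp add: wt_env_upd)
qed

lemma Mem_cong_left: "\<Gamma> \<turnstile> Eq s t \<Longrightarrow> \<Gamma> \<turnstile> Mem s X \<Longrightarrow> \<Gamma> \<turnstile> Mem t X"
  by (meson Mem_cong Eq_refl derives_wf has_type_MemE)

lemma pair_cong:
  assumes "\<Gamma> \<turnstile> Eq s s'" "\<Gamma> \<turnstile> Eq t t'"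
  shows "\<Gamma> \<turnstile> Eq (pair s t) (pair s' t')"
proof -
  from assms[THEN derives_wf(2)] obtain A B where A: "term_of L s A" "term_of L s' A"
    "term_of L t B" "term_of L t' B"
    by (auto elim!: has_type_EqE)
  \<comment> \<open>\<open>?w\<close> stands for the unchanged left side \<open>pair s t\<close>
    while the components on the right are rewritten in turn.\<close>
  let ?u = "(0, A)" and ?v = "(1, B)" and ?w = "(2, Prod [A, B])"
  have P: "term_of L (pair s t) (Prod [A, B])" using A by (intro has_type_pair)
  have "term_of L (Var ?u) A" "term_of L (Var ?v) B" "term_of L (Var ?w) (Prod [A, B])"
    using is_type[OF A(1)] is_type[OF A(3)] is_type[OF P] has_type.intros(2)[of L ?u]
     has_type.intros(2)[of L ?v] has_type.intros(2)[of L ?w] by auto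
  then have \<alpha>: "formula L (Eq (Var ?w) (pair (Var ?u) (Var ?v)))"
    using has_type.intros(8) has_type_pair by blast
  from leibniz[OF assms(1) _ \<alpha>, of ?u "Var(?v := t, ?w := pair s t)"] A P
    Eq_refl[OF P derives_wf(1)[OF assms(1)]]
  have "\<Gamma> \<turnstile> Eq (pair s t) (pair s' t)" by (simp add: wt_env_upd)
  with leibniz[OF assms(2) _ \<alpha>, of ?v "Var(?u := s', ?w := pair s t)"] A P
  show ?thesis by (simp add: wt_env_upd)
qed

lemma Proj_Tuple:
  assumes ts: "term_of L (Tuple ts) (Prod As)" and i: "i < length ts" and "ctx \<Gamma>"
  shows "\<Gamma> \<turnstile> Eq (Proj i (Tuple ts)) (ts ! i)"
proof -
  let ?xs = "zip [0..<length As] As"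
  from ts have *: "length ts \<ge> 2" "list_all2 (term_of L) ts As" by (auto elim: has_type_TupleE)
  then have len: "length ts = length As" by (simp add: list_all2_lengthD)
  have d: "distinct ?xs" by (simp add: distinct_zipI1)
  have xs: "map snd ?xs = As" by simp
  have "\<And>x. x \<in> set ?xs \<Longrightarrow> is_type L (snd x)"
    using is_type[OF ts] by (auto elim!: is_type_ProdE dest: set_zip_rightD)
  then have "{} \<turnstile> Eq (Proj i (Tuple (map Var ?xs))) (Var (?xs ! i))"
    using * i len by (intro proj_tuple) auto
  from derives_msubst[OF this, of "env_of ?xs ts"] *
  have "{} \<turnstile> Eq (Proj i (Tuple (map (env_of ?xs ts) ?xs))) (env_of ?xs ts (?xs ! i))"
    by (simp add: wt_env_env_of comp_def)
  moreover have "map (env_of ?xs ts) ?xs = ts" "env_of ?xs ts (?xs ! i) = ts ! i"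
    using i len d by (simp_all only: map_env_of env_of_nth length_zip length_upt)
  ultimately have "{} \<turnstile> Eq (Proj i (Tuple ts)) (ts ! i)"
    by simp
  then show ?thesis using assms(3) by (rule weaken0)
qed

text \<open>Leibniz' rule applies \<open>Proj i\<close> to both sides, and \<open>Proj_Tuple\<close>
  evaluates the projections. The common product type forces the two lengths to agree.\<close>

lemma Tuple_inject:
  assumes eq: "\<Gamma> \<turnstile> Eq (Tuple ss) (Tuple ts)" and i: "i < length ss"
  shows "\<Gamma> \<turnstile> Eq (ss ! i) (ts ! i)"
proof -
  from derives_wf(2)[OF eq] obtain As where s: "term_of L (Tuple ss) (Prod As)"
    and t: "term_of L (Tuple ts) (Prod As)"
    by (auto elim!: has_type_EqE elim: has_type_TupleE)
  then have len: "length As = length ss" "length ts = length ss"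
    by (auto elim!: has_type_TupleE simp: list_all2_lengthD)
  let ?v = "(0, Prod As)" and ?w = "(1, Prod As)"
  have v: "term_of L (Var ?v) (Prod As)" "term_of L (Var ?w) (Prod As)"
    using is_type[OF s] has_type.intros(2)[of L ?v] has_type.intros(2)[of L ?w] by auto
  have "formula L (Eq (Proj i (Var ?v)) (Proj i (Var ?w)))"
    using v i len by (intro has_type.intros(8)[of _ _ _ "As ! i"] has_type.intros(6)) simp_all
  moreover have "term_of L (Proj i (Tuple ss)) (As ! i)" using s i len by (intro has_type.intros(6)) simp_all
  ultimately have "\<Gamma> \<turnstile> Eq (Proj i (Tuple ss)) (Proj i (Tuple ts))"
    using leibniz[OF eq, of ?w "Eq (Proj i (Var ?v)) (Proj i (Var ?w))" "Var(?v := Tuple ss)"] s derives_wf(1)[OF eq]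
    by (simp add: wt_env_upd Eq_refl)
  then show ?thesis
    using Proj_Tuple[OF s i derives_wf(1)[OF eq]] Proj_Tuple[OF t _ derives_wf(1)[OF eq]] i len
    by (metis Eq_sym Eq_trans)
qed

text \<open>Here the lengths must be assumed equal: \<open>tuple [t]\<close> is \<open>t\<close>
  itself, which may be a longer tuple.\<close>

lemma tuple_inject:
  assumes "\<Gamma> \<turnstile> Eq (tuple ss) (tuple ts)" "length ss = length ts" "i < length ss"
  shows "\<Gamma> \<turnstile> Eq (ss ! i) (ts ! i)"
  using assms Tuple_inject[of \<Gamma> ss ts i]
  by (cases ss rule: tuple.cases; cases ts rule: tuple.cases; simp)

lemma pair_inject:
  assumes "\<Gamma> \<turnstile> Eq (pair s t) (pair s' t')"
  shows "\<Gamma> \<turnstile> Eq s s'" "\<Gamma> \<turnstile> Eq t t'"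
  using Tuple_inject[OF assms, of 0] Tuple_inject[OF assms, of 1] by auto

lemma tuple_cong:
  assumes eq: "list_all2 (\<lambda>s t. \<Gamma> \<turnstile> Eq s t) ss ts" and "ctx \<Gamma>"
  shows "\<Gamma> \<turnstile> Eq (tuple ss) (tuple ts)"
proof -
  have len: "length ss = length ts" using eq by (rule list_all2_lengthD)
  have "\<exists>As. list_all2 (term_of L) ss As"
    using eq by (induction ss ts rule: list_all2_induct) (auto dest!: derives_wf(2) elim!: has_type_EqE intro: exI[of _ "_ # _"])
  then obtain As where s: "list_all2 (term_of L) ss As" ..
  then have lA: "length ss = length As" by (rule list_all2_lengthD)
  have t: "list_all2 (term_of L) ts As"
    using s eq eq_type by (auto simp: list_all2_conv_all_nth)
  \<comment> \<open>The names start at 1 so that name 0 is left for \<open>?w\<close>, the hole that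
    keeps \<open>tuple ss\<close> fixed on the left while the right side is rewritten.\<close>
  let ?xs = "zip [1..<Suc (length As)] As" and ?w = "(0, prodT As)"
  let ?e = "env_of ?xs"
  have d: "distinct ?xs" by (simp add: distinct_zipI1 del: upt_Suc)
  have w: "?w \<notin> set ?xs" by (auto simp del: upt_Suc dest: set_zip_leftD)
  have snd: "map snd ?xs = As" by (simp del: upt_Suc)
  have P: "term_of L (tuple ss) (prodT As)" using s by (rule has_type_tuple)
  have "list_all2 (term_of L) (map Var ?xs) As"
    using s by (auto simp: list_all2_conv_all_nth intro!: has_type_Var intro: is_type simp del: upt_Suc)
  then have "formula L (Eq (Var ?w) (tuple (map Var ?xs)))"
    using is_type[OF P] has_type.intros(2)[of L ?w] by (intro has_type.intros(8)[OF _ has_type_tuple]) auto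
  moreover define E where "E us = (?e us)(?w := tuple ss)" for us
  have map_E: "map (E ss) ?xs = ss" "map (E ts) ?xs = ts"
    using w d len lA by (simp_all add: map_env_of E_def del: upt_Suc)
  moreover have "wt_env L (E ss)" "wt_env L (E ts)"
    using P s t snd by (auto intro!: wt_env_upd wt_env_env_of simp: E_def simp del: upt_Suc)
  moreover have "\<Gamma> \<turnstile> Eq (E ss v) (E ts v)"
    if "v \<in> fv (Eq (Var ?w) (tuple (map Var ?xs)))" for v
  proof (cases "v = ?w")
    case True
    then show ?thesis using Eq_refl[OF P \<open>ctx \<Gamma>\<close>] by (simp add: E_def)
  next
    case False
    with that obtain i where "v = ?xs ! i" "i < length As"
      by (auto simp: in_set_conv_nth simp del: upt_Suc)
    with False show ?thesis using eq d len lA env_of_nth[of ?xs ss i] env_of_nth[of ?xs ts i]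
      by (auto simp: E_def list_all2_conv_all_nth simp del: upt_Suc)
  qed
  moreover have "msubst (E us) (Eq (Var ?w) (tuple (map Var ?xs))) = Eq (tuple ss) (tuple (map (E us) ?xs))" for us
  proof -
    have "E us ?w = tuple ss" by (simp add: E_def)
    then show ?thesis by (simp add: comp_def del: upt_Suc)
  qed
  ultimately show ?thesis
    using leibniz_env[of "Eq (Var ?w) (tuple (map Var ?xs))" \<Gamma> "E ss" "E ts"]
      Eq_refl[OF P \<open>ctx \<Gamma>\<close>] by metis
qed

subsection \<open>Logical connectives\<close>

lemma TT_intro: "ctx \<Gamma> \<Longrightarrow> \<Gamma> \<turnstile> TT"
  unfolding TT_def by (rule Eq_refl) (auto intro: has_type.intros)

text \<open>Through this equation and its converse, a conjunction, which is an equation between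
  pairs, is introduced and eliminated by \<open>pair_cong\<close> and
  \<open>pair_inject\<close>.\<close>

lemma Eq_TT_intro:
  assumes "\<Gamma> \<turnstile> \<alpha>"
  shows "\<Gamma> \<turnstile> Eq \<alpha> TT"
  using derives_wf[OF assms] by (intro equivalence TT_intro weaken[OF assms]) auto

lemma Eq_TT_elim: "\<Gamma> \<turnstile> Eq \<alpha> TT \<Longrightarrow> \<Gamma> \<turnstile> \<alpha>"
  by (meson Eq_mp Eq_sym TT_intro derives_wf(1))

lemma And_intro: "\<Gamma> \<turnstile> \<alpha> \<Longrightarrow> \<Gamma> \<turnstile> \<beta> \<Longrightarrow> \<Gamma> \<turnstile> And \<alpha> \<beta>"
  unfolding And_def by (intro pair_cong Eq_TT_intro)

lemma And_elim1: "\<Gamma> \<turnstile> And \<alpha> \<beta> \<Longrightarrow> \<Gamma> \<turnstile> \<alpha>"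
  and And_elim2: "\<Gamma> \<turnstile> And \<alpha> \<beta> \<Longrightarrow> \<Gamma> \<turnstile> \<beta>"
  unfolding And_def by (auto dest: pair_inject intro: Eq_TT_elim)

lemma Imp_intro:
  assumes "insert \<alpha> \<Gamma> \<turnstile> \<beta>"
  shows "\<Gamma> \<turnstile> Imp \<alpha> \<beta>"
  unfolding Imp_def
proof (rule equivalence)
  have *: "formula L \<alpha>" "ctx \<Gamma>" "formula L \<beta>" using derives_wf[OF assms] by auto
  then show "insert (And \<alpha> \<beta>) \<Gamma> \<turnstile> \<alpha>"
    by (intro And_elim1[OF assumption]) (auto intro: has_type_And)
  show "insert \<alpha> \<Gamma> \<turnstile> And \<alpha> \<beta>"
    using * by (intro And_intro[OF _ assms] assumption) auto
qed

lemma Imp_elim: "\<Gamma> \<turnstile> Imp \<alpha> \<beta> \<Longrightarrow> \<Gamma> \<turnstile> \<alpha> \<Longrightarrow> \<Gamma> \<turnstile> \<beta>"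
  unfolding Imp_def by (meson And_elim2 Eq_mp Eq_sym)

lemma And_left:
  assumes "insert \<alpha> (insert \<beta> \<Gamma>) \<turnstile> \<delta>"
  shows "insert (And \<alpha> \<beta>) \<Gamma> \<turnstile> \<delta>"
proof (rule cut_set[OF assms])
  have *: "formula L \<alpha>" "ctx \<Gamma>" "formula L \<beta>" using derives_wf[OF assms] by auto
  then show c: "ctx (insert (And \<alpha> \<beta>) \<Gamma>)" by (simp add: has_type_And)
  show "insert (And \<alpha> \<beta>) \<Gamma> \<turnstile> \<gamma>" if "\<gamma> \<in> insert \<alpha> (insert \<beta> \<Gamma>)" for \<gamma>
    using that c And_elim1[OF assumption[OF _ c]] And_elim2[OF assumption[OF _ c]]
    by (auto intro: assumption)
qed

lemma Mem_compr:
  assumes "formula L \<alpha>" "term_of L \<tau> (snd x)" "ctx \<Gamma>"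
  shows "\<Gamma> \<turnstile> Eq (Mem \<tau> (compr x \<alpha>)) (msubst (Var(x := \<tau>)) \<alpha>)"
proof -
  have "{} \<turnstile> Eq (Mem (Var x) (compr x \<alpha>)) \<alpha>"
    using assms is_type by (intro comprehension) auto
  from derives_msubst_term[OF this assms(2)]
  have "{} \<turnstile> Eq (Mem \<tau> (msubst (Var(x := \<tau>)) (compr x \<alpha>))) (msubst (Var(x := \<tau>)) \<alpha>)" by simp
  moreover have "msubst (Var(x := \<tau>)) (compr x \<alpha>) = compr x \<alpha>"
    by (rule msubst_ident) auto
  ultimately show ?thesis using assms(3) by (simp add: weaken0)
qed

text \<open>A universal formula is an equation between two comprehensions, so extensionality
  applies, and the freshness of \<open>x\<close> is exactly its side condition.\<close>

lemma Forall_intro: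
  assumes "\<Gamma> \<turnstile> \<alpha>" "\<And>\<gamma>. \<gamma> \<in> \<Gamma> \<Longrightarrow> x \<notin> fv \<gamma>" "is_type L (snd x)"
  shows "\<Gamma> \<turnstile> Forall x \<alpha>"
  unfolding Forall_def
proof (rule extensionality)
  note wf = derives_wf[OF assms(1)]
  have x: "term_of L (Var x) (snd x)" using assms(3) by (simp add: has_type_Var)
  show "\<Gamma> \<turnstile> Eq (Mem (Var x) (compr x \<alpha>)) (Mem (Var x) (compr x TT))"
    using Mem_compr[OF wf(2) x wf(1)] Mem_compr[OF has_type_TT x wf(1)] Eq_TT_intro[OF assms(1)]
    by (simp add: fun_upd_idem) (meson Eq_sym Eq_trans)
qed (use assms(2) in auto)

lemma Forall_elim:
  assumes "\<Gamma> \<turnstile> Forall x \<alpha>" "formula L \<alpha>" "term_of L \<tau> (snd x)"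
  shows "\<Gamma> \<turnstile> msubst (Var(x := \<tau>)) \<alpha>"
proof -
  note c = derives_wf(1)[OF assms(1)]
  have "\<Gamma> \<turnstile> Mem \<tau> (compr x TT)"
    using Mem_compr[OF has_type_TT assms(3) c] by (simp add: Eq_TT_elim)
  with assms(1) have "\<Gamma> \<turnstile> Mem \<tau> (compr x \<alpha>)"
    unfolding Forall_def by (meson Mem_cong Eq_sym Eq_refl assms(3) c)
  then show ?thesis using Mem_compr[OF assms(2,3) c] Eq_mp by blast
qed

lemma Or_intro:
  assumes "\<Gamma> \<turnstile> \<alpha> \<or> \<Gamma> \<turnstile> \<beta>" "formula L \<alpha>" "formula L \<beta>"
  shows "\<Gamma> \<turnstile> Or \<alpha> \<beta>"
proof -
  define w :: "'g var" where "w = fresh_var Omega (fv \<alpha> \<union> fv \<beta>)"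
  have w: "w \<notin> fv \<alpha> \<union> fv \<beta>" "snd w = Omega" unfolding w_def by (rule fresh_var; simp)+
  have wt: "formula L (Var w)" using w by (intro has_type_Var is_type.intros)
  let ?H = "And (Imp \<alpha> (Var w)) (Imp \<beta> (Var w))"
  have H: "formula L ?H" using assms wt by (intro has_type_And has_type_Imp)
  \<comment> \<open>The context is reduced to \<delta>, since \<open>w\<close> is fresh for \<alpha>
    and \<beta> but may well occur in \<Gamma>; a cut restores \<Gamma>.\<close>
  have "{\<delta>} \<turnstile> Forall w (Imp ?H (Var w))" if "\<delta> = \<alpha> \<or> \<delta> = \<beta>" for \<delta>
  proof (intro Forall_intro Imp_intro)
    have c: "ctx {?H, \<delta>}" using H that assms by auto
    have "{?H, \<delta>} \<turnstile> Imp \<alpha> (Var w)" "{?H, \<delta>} \<turnstile> Imp \<beta> (Var w)"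
      using And_elim1[OF assumption[OF _ c]] And_elim2[OF assumption[OF _ c]] by blast+
    then show "{?H, \<delta>} \<turnstile> Var w"
      using that Imp_elim assumption[OF _ c] by blast
  qed (use w that in \<open>auto intro: is_type.intros\<close>)
  then show ?thesis unfolding Or_def Let_def w_def[symmetric] using assms(1) cut1 by blast
qed

text \<open>Disjunction is encoded by quantifying over a formula variable \<open>w\<close>; it is
  eliminated by taking the desired conclusion \<delta> for \<open>w\<close>. The same choice is made
  in \<open>Exists_left\<close>.\<close>

lemma Or_left:
  assumes "insert \<alpha> \<Gamma> \<turnstile> \<delta>" "insert \<beta> \<Gamma> \<turnstile> \<delta>"
  shows "insert (Or \<alpha> \<beta>) \<Gamma> \<turnstile> \<delta>"
proof -
  have *: "formula L \<alpha>" "formula L \<beta>" "formula L \<delta>" "ctx \<Gamma>"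
    using derives_wf[OF assms(1)] derives_wf[OF assms(2)] by auto
  define w :: "'g var" where "w = fresh_var Omega (fv \<alpha> \<union> fv \<beta>)"
  have w: "w \<notin> fv \<alpha> \<union> fv \<beta>" "snd w = Omega" unfolding w_def by (rule fresh_var; simp)+
  have wt: "formula L (Var w)" using w by (intro has_type_Var is_type.intros)
  let ?\<Delta> = "insert (Or \<alpha> \<beta>) \<Gamma>"
  have c: "ctx ?\<Delta>" using * by (simp add: has_type_Or)
  have "?\<Delta> \<turnstile> Forall w (Imp (And (Imp \<alpha> (Var w)) (Imp \<beta> (Var w))) (Var w))"
    using assumption[OF _ c, of "Or \<alpha> \<beta>"] by (simp add: Or_def Let_def w_def)
  from Forall_elim[OF this, of \<delta>] * w wt
  have "?\<Delta> \<turnstile> Imp (And (Imp (msubst (Var(w := \<delta>)) \<alpha>) \<delta>) (Imp (msubst (Var(w := \<delta>)) \<beta>) \<delta>)) \<delta>"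
    by (simp add: has_type_And has_type_Imp)
  moreover have "msubst (Var(w := \<delta>)) \<alpha> = \<alpha>" "msubst (Var(w := \<delta>)) \<beta> = \<beta>"
    using w by (auto intro!: msubst_ident)
  moreover have "?\<Delta> \<turnstile> And (Imp \<alpha> \<delta>) (Imp \<beta> \<delta>)"
    using c * assms by (intro And_intro Imp_intro weaken[OF assms(1)] weaken[OF assms(2)]) auto
  ultimately show ?thesis using Imp_elim by metis
qed

lemma Exists_intro:
  assumes "\<Gamma> \<turnstile> \<alpha>" "is_type L (snd x)"
  shows "\<Gamma> \<turnstile> Exists x \<alpha>"
proof -
  note wf = derives_wf[OF assms(1)]
  define w :: "'g var" where "w = fresh_var Omega (insert x (fv \<alpha>))"
  have w: "w \<notin> insert x (fv \<alpha>)" "snd w = Omega" unfolding w_def by (rule fresh_var; simp)+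
  have wt: "formula L (Var w)" using w by (intro has_type_Var is_type.intros)
  let ?H = "Forall x (Imp \<alpha> (Var w))"
  have H: "formula L (Imp \<alpha> (Var w))" "formula L ?H" using assms wf wt by (auto intro!: has_type_Forall has_type_Imp)
  \<comment> \<open>As for disjunction, \<open>w\<close> may occur in \<Gamma>, so the quantifier is
    introduced over \<alpha> alone.\<close>
  have "{\<alpha>} \<turnstile> Forall w (Imp ?H (Var w))"
  proof (intro Forall_intro Imp_intro)
    have c: "ctx {?H, \<alpha>}" using H wf by auto
    have "{?H, \<alpha>} \<turnstile> Imp \<alpha> (Var w)"
      using Forall_elim[OF assumption[of ?H "{?H, \<alpha>}"] H(1), of "Var x"] c assms(2)
      by (simp add: has_type_Var fun_upd_idem)
    then show "{?H, \<alpha>} \<turnstile> Var w"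
      using Imp_elim assumption[OF _ c] by blast
  qed (use w in \<open>auto intro: is_type.intros\<close>)
  then show ?thesis unfolding Exists_def Let_def w_def[symmetric] using assms(1) cut1 by blast
qed

lemma Exists_left:
  assumes "insert \<alpha> \<Gamma> \<turnstile> \<delta>" "is_type L (snd x)" "\<And>\<gamma>. \<gamma> \<in> \<Gamma> \<Longrightarrow> x \<notin> fv \<gamma>" "x \<notin> fv \<delta>"
  shows "insert (Exists x \<alpha>) \<Gamma> \<turnstile> \<delta>"
proof -
  have *: "formula L \<alpha>" "formula L \<delta>" "ctx \<Gamma>"
    using derives_wf[OF assms(1)] by auto
  define w :: "'g var" where "w = fresh_var Omega (insert x (fv \<alpha>))"
  have w: "w \<notin> insert x (fv \<alpha>)" "snd w = Omega" unfolding w_def by (rule fresh_var; simp)+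
  have wt: "formula L (Var w)" using w by (intro has_type_Var is_type.intros)
  let ?\<Delta> = "insert (Exists x \<alpha>) \<Gamma>"
  have c: "ctx ?\<Delta>" using * assms(2) by (simp add: has_type_Exists)
  have "?\<Delta> \<turnstile> Forall w (Imp (Forall x (Imp \<alpha> (Var w))) (Var w))"
    using assumption[OF _ c, of "Exists x \<alpha>"] by (simp add: Exists_def Let_def w_def)
  from Forall_elim[OF this, of \<delta>] * w wt assms(2)
  have "?\<Delta> \<turnstile> Imp (msubst (Var(w := \<delta>)) (Forall x (Imp \<alpha> (Var w)))) \<delta>"
    by (simp add: has_type_Forall has_type_Imp)
  \<comment> \<open>This is where \<open>x\<close> must not be free in \<delta>: otherwise the
    quantifier would capture it.\<close>
  moreover have "msubst (Var(w := \<delta>)) (Forall x (Imp \<alpha> (Var w))) = Forall x (msubst (Var(w := \<delta>)) (Imp \<alpha> (Var w)))"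
    using w assms(4) by (intro msubst_Forall) auto
  moreover have "msubst (Var(w := \<delta>)) \<alpha> = \<alpha>"
    using w by (auto intro!: msubst_ident)
  moreover have "?\<Delta> \<turnstile> Forall x (Imp \<alpha> \<delta>)"
    using c * assms by (intro Forall_intro Imp_intro weaken[OF assms(1)]) auto
  ultimately show ?thesis using Imp_elim[of ?\<Delta> "Forall x (Imp \<alpha> \<delta>)" \<delta>] by simp
qed

lemma foldr_Exists_intro:
  "\<Gamma> \<turnstile> \<alpha> \<Longrightarrow> (\<And>x. x \<in> set xs \<Longrightarrow> is_type L (snd x)) \<Longrightarrow> \<Gamma> \<turnstile> foldr Exists xs \<alpha>"
  by (induction xs) (auto intro: Exists_intro)

lemma foldr_Exists_left:
  assumes "insert \<alpha> \<Gamma> \<turnstile> \<delta>" "\<And>x. x \<in> set xs \<Longrightarrow> is_type L (snd x)"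
    "\<And>\<gamma>. \<gamma> \<in> \<Gamma> \<Longrightarrow> set xs \<inter> fv \<gamma> = {}" "set xs \<inter> fv \<delta> = {}"
  shows "insert (foldr Exists xs \<alpha>) \<Gamma> \<turnstile> \<delta>"
  using assms
proof (induction xs)
  case (Cons x xs)
  then have "insert (foldr Exists xs \<alpha>) \<Gamma> \<turnstile> \<delta>" by auto
  then have "insert (Exists x (foldr Exists xs \<alpha>)) \<Gamma> \<turnstile> \<delta>"
    using Cons.prems by (intro Exists_left) auto
  then show ?case by simp
qed simp

section \<open>Sets described by terms\<close>

text \<open>
  \<open>K\<close> behaves as the closed set \<open>{\<sigma> : \<alpha>}\<close> with all variables in \<open>vs\<close> bound.
\<close>

definition describes :: "('g, 'f) tm \<Rightarrow> 'g ty \<Rightarrow> 'g var set \<Rightarrow> ('g, 'f) tm \<Rightarrow> ('g, 'f) tm \<Rightarrow> bool" where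
  "describes K C vs \<sigma> \<alpha> \<longleftrightarrow>
     fv K = {} \<and> term_of L K (Pow C) \<and> finite vs \<and> fv \<sigma> \<union> fv \<alpha> \<subseteq> vs \<and> {\<alpha>} \<turnstile> Mem \<sigma> K \<and>
     (\<forall>\<Gamma> \<rho> \<beta>. insert (Eq \<rho> \<sigma>) (insert \<alpha> \<Gamma>) \<turnstile> \<beta> \<longrightarrow> vs \<inter> (\<Union>(fv ` \<Gamma>) \<union> fv \<rho> \<union> fv \<beta>) = {} \<longrightarrow>
        insert (Mem \<rho> K) \<Gamma> \<turnstile> \<beta>)"

lemma describesI:
  assumes "fv K = {}" "term_of L K (Pow C)" "finite vs" "fv \<sigma> \<union> fv \<alpha> \<subseteq> vs" "{\<alpha>} \<turnstile> Mem \<sigma> K"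
    "\<And>\<Gamma> \<rho> \<beta>. insert (Eq \<rho> \<sigma>) (insert \<alpha> \<Gamma>) \<turnstile> \<beta> \<Longrightarrow> vs \<inter> (\<Union>(fv ` \<Gamma>) \<union> fv \<rho> \<union> fv \<beta>) = {} \<Longrightarrow>
        insert (Mem \<rho> K) \<Gamma> \<turnstile> \<beta>"
  shows "describes K C vs \<sigma> \<alpha>"
  unfolding describes_def using assms by (intro conjI allI impI)

lemma describes_left:
  assumes "describes K C vs \<sigma> \<alpha>" "insert (Eq \<rho> \<sigma>) (insert \<alpha> \<Gamma>) \<turnstile> \<beta>"
    "vs \<inter> (\<Union>(fv ` \<Gamma>) \<union> fv \<rho> \<union> fv \<beta>) = {}"
  shows "insert (Mem \<rho> K) \<Gamma> \<turnstile> \<beta>"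
  using assms unfolding describes_def by meson

lemma describes_compr_tm:
  assumes xs: "\<And>x. x \<in> set xs \<Longrightarrow> is_type L (snd x)" and \<sigma>: "term_of L \<sigma> C" and \<alpha>: "formula L \<alpha>"
    and sub: "fv \<sigma> \<union> fv \<alpha> \<subseteq> set xs"
  shows "describes (compr_tm xs C \<sigma> \<alpha>) C (set xs) \<sigma> \<alpha>"
proof -
  define z where "z = fresh_var C (set xs \<union> fv \<sigma> \<union> fv \<alpha>)"
  have z: "z \<notin> set xs \<union> fv \<sigma> \<union> fv \<alpha>" "snd z = C"
    unfolding z_def by (rule fresh_var; simp)+
  let ?\<phi> = "foldr Exists xs (And (Eq (Var z) \<sigma>) \<alpha>)" and ?K = "compr_tm xs C \<sigma> \<alpha>"
  have K: "?K = compr z ?\<phi>" by (simp add: compr_tm_def Let_def z_def)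
  have C: "is_type L C" by (rule is_type[OF \<sigma>])
  have vz: "term_of L (Var z) C" using C z by (intro has_type_Var)
  have \<phi>: "formula L ?\<phi>"
    using vz \<sigma> \<alpha> xs by (intro has_type_foldr_Exists has_type_And has_type.intros(8)) auto
  have fvK: "fv ?K = {}" using sub by (auto simp: K)
  have tK: "term_of L ?K (Pow C)" unfolding K using \<phi> C z has_type_compr by blast
  have sub_\<sigma>: "msubst (Var(z := \<rho>)) \<sigma> = \<sigma>" "msubst (Var(z := \<rho>)) \<alpha> = \<alpha>" for \<rho>
    using z by (auto intro!: msubst_ident)
  have mem: "\<Gamma> \<turnstile> Eq (Mem \<rho> ?K) (msubst (Var(z := \<rho>)) ?\<phi>)" if "term_of L \<rho> C" "ctx \<Gamma>" for \<rho> \<Gamma>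
    unfolding K using Mem_compr[OF \<phi>, of \<rho> z] that z by simp
  have "{\<alpha>} \<turnstile> Mem \<sigma> ?K"
  proof -
    have c: "ctx {Eq (Var z) \<sigma>, \<alpha>}" using vz \<sigma> \<alpha> by (auto intro: has_type.intros)
    then have "{Eq (Var z) \<sigma>, \<alpha>} \<turnstile> ?\<phi>"
      using xs by (intro foldr_Exists_intro And_intro) (auto intro: assumption)
    then have "{Eq (Var z) \<sigma>, \<alpha>} \<turnstile> Mem (Var z) ?K"
      using mem[OF vz c] by (simp add: fun_upd_idem) (meson Eq_mp Eq_sym)
    \<comment> \<open>Putting \<sigma> for \<open>z\<close> turns the hypothesis z = \<sigma> into
      \<sigma> = \<sigma>, which is then cut.\<close>
    from derives_msubst_term[OF this, of \<sigma> z] z \<sigma>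
    have "{Eq \<sigma> \<sigma>, \<alpha>} \<turnstile> Mem \<sigma> ?K" by (simp add: sub_\<sigma> msubst_closed[OF fvK])
    then show ?thesis using \<alpha> by (intro cut2[OF _ Eq_refl[OF \<sigma>] tautology]) auto
  qed
  moreover have "insert (Mem \<rho> ?K) \<Gamma> \<turnstile> \<beta>"
    if der: "insert (Eq \<rho> \<sigma>) (insert \<alpha> \<Gamma>) \<turnstile> \<beta>"
      and fresh: "set xs \<inter> (\<Union>(fv ` \<Gamma>) \<union> fv \<rho> \<union> fv \<beta>) = {}" for \<Gamma> \<rho> \<beta>
  proof -
    have c: "ctx \<Gamma>" and "formula L (Eq \<rho> \<sigma>)" using derives_wf[OF der] by auto
    then have \<rho>: "term_of L \<rho> C" using \<sigma> has_type_unique by (blast elim: has_type_EqE)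
    have "insert (foldr Exists xs (And (Eq \<rho> \<sigma>) \<alpha>)) \<Gamma> \<turnstile> \<beta>"
      using der fresh xs by (intro foldr_Exists_left And_left) auto
    moreover have "msubst (Var(z := \<rho>)) ?\<phi> = foldr Exists xs (And (Eq \<rho> \<sigma>) \<alpha>)"
      using z fresh by (subst msubst_foldr_Exists) (auto simp: sub_\<sigma>)
    moreover have "insert (Mem \<rho> ?K) \<Gamma> \<turnstile> msubst (Var(z := \<rho>)) ?\<phi>"
      using mem[OF \<rho>, of "insert (Mem \<rho> ?K) \<Gamma>"] assumption[of "Mem \<rho> ?K" "insert (Mem \<rho> ?K) \<Gamma>"] c
        has_type.intros(9)[OF \<rho> tK] Eq_mp by auto
    ultimately show ?thesis by (auto intro: insert_cong_left)
  qed
  ultimately show ?thesis using fvK tK sub by (auto simp: describes_def)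
qed

lemma describes_closed: "describes K C vs \<sigma> \<alpha> \<Longrightarrow> fv K = {}"
  and describes_type: "describes K C vs \<sigma> \<alpha> \<Longrightarrow> term_of L K (Pow C)"
  by (auto simp: describes_def)

lemma describes_intro:
  assumes "describes K C vs \<sigma> \<alpha>" "wt_env L e" "\<Gamma> \<turnstile> msubst e \<alpha>"
  shows "\<Gamma> \<turnstile> Mem (msubst e \<sigma>) K"
proof -
  have "{\<alpha>} \<turnstile> Mem \<sigma> K" "fv K = {}" using assms(1) by (auto simp: describes_def)
  from derives_msubst[OF this(1) assms(2)] this(2) have "{msubst e \<alpha>} \<turnstile> Mem (msubst e \<sigma>) K"
    by (simp add: msubst_closed)
  then show ?thesis using assms(3) by (rule cut1)
qed

text \<open>
  The eigenvariables \<open>vs\<close> may be replaced by any copies: all other variables are moved out of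
  the way by a shift of their names, which is undone at the end.
\<close>

lemma describes_elim:
  assumes K: "describes K C vs \<sigma> \<alpha>" and mem: "\<Gamma> \<turnstile> Mem \<rho> K" and V: "finite V" and \<beta>: "formula L \<beta>"
    and step: "\<And>r. (\<And>v. snd (r v) = snd v) \<Longrightarrow> inj r \<Longrightarrow> range r \<inter> V = {} \<Longrightarrow>
      range r \<inter> (\<Union>(fv ` \<Gamma>) \<union> fv \<rho> \<union> fv \<beta>) = {} \<Longrightarrow>
      insert (Eq \<rho> (msubst (\<lambda>v. Var (r v)) \<sigma>)) (insert (msubst (\<lambda>v. Var (r v)) \<alpha>) \<Gamma>) \<turnstile> \<beta>"
  shows "\<Gamma> \<turnstile> \<beta>"
proof -
  from K have vs: "finite vs" "fv \<sigma> \<subseteq> vs" "fv \<alpha> \<subseteq> vs" "fv K = {}"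
    unfolding describes_def by blast+
  let ?W = "\<Union>(fv ` \<Gamma>) \<union> fv \<rho> \<union> fv \<beta>"
  have fin: "finite (V \<union> ?W)" using V derives_wf(1)[OF mem] by (auto simp: ctx_def)
  obtain N where N: "\<forall>v \<in> V \<union> ?W. fst v < N" using fst_bound[OF fin] ..
  obtain M where M: "\<forall>v \<in> vs. fst v < M" using fst_bound[OF vs(1)] ..
  define r where "r = (\<lambda>v::'g var. (fst v + N, snd v))"
  define s where "s = (\<lambda>v::'g var. (fst v + M, snd v))"
  define s' where "s' = (\<lambda>v::'g var. (fst v - M, snd v))"
  \<comment> \<open>All names of the context lie below \<open>N\<close> and those in
    \<open>vs\<close> below \<open>M\<close>. Hence \<open>q\<close> does two things at once: it
    inverts \<open>r\<close>, returning the copies to \<open>vs\<close>, and it pushes the context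
    past \<open>vs\<close> by adding \<open>M\<close>. The map \<open>s'\<close> later subtracts
    \<open>M\<close> again.\<close>
  define q where "q = (\<lambda>v::'g var. if fst v < N then s v else (fst v - N, snd v))"
  have q: "wt_env L (\<lambda>v. Var (q v) :: ('g, 'f) tm)" by (rule wt_env_rename) (simp add: q_def s_def)
  have s': "wt_env L (\<lambda>v. Var (s' v) :: ('g, 'f) tm)" by (rule wt_env_rename) (simp add: s'_def)
  let ?q = "msubst (\<lambda>v. Var (q v)) :: ('g, 'f) tm \<Rightarrow> ('g, 'f) tm"
  let ?s' = "msubst (\<lambda>v. Var (s' v)) :: ('g, 'f) tm \<Rightarrow> ('g, 'f) tm"
  have r_notin: "r v \<notin> V \<union> ?W" for v using bspec[OF N, of "r v"] by (auto simp: r_def)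
  have "insert (Eq \<rho> (msubst (\<lambda>v. Var (r v)) \<sigma>)) (insert (msubst (\<lambda>v. Var (r v)) \<alpha>) \<Gamma>) \<turnstile> \<beta>"
  proof (rule step)
    show "range r \<inter> V = {}" "range r \<inter> ?W = {}" using r_notin by blast+
  qed (auto simp: r_def inj_on_def prod_eq_iff)
  from derives_msubst[OF this q]
  have "insert (Eq (?q \<rho>) \<sigma>) (insert \<alpha> (?q ` \<Gamma>)) \<turnstile> ?q \<beta>"
    by (simp add: msubst_msubst q_def r_def)
  moreover have "vs \<inter> (\<Union>(fv ` ?q ` \<Gamma>) \<union> fv (?q \<rho>) \<union> fv (?q \<beta>)) = {}"
  proof -
    have "q v \<notin> vs" if "v \<in> ?W" for v
      using bspec[OF N, of v] that bspec[OF M, of "q v"] by (auto simp: q_def s_def)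
    then have "fv (?q t) \<inter> vs = {}" if "fv t \<subseteq> ?W" for t
      using that unfolding fv_msubst by force
    then show ?thesis by blast
  qed
  ultimately have "insert (Mem (?q \<rho>) K) (?q ` \<Gamma>) \<turnstile> ?q \<beta>" by (rule describes_left[OF K])
  from derives_msubst[OF this s']
  have "insert (Mem (?s' (?q \<rho>)) K) (?s' ` ?q ` \<Gamma>) \<turnstile> ?s' (?q \<beta>)"
    by (simp add: msubst_closed[OF vs(4)])
  moreover have "?s' (?q t) = t" if "fv t \<subseteq> ?W" for t
    unfolding msubst_msubst
  proof (rule msubst_ident)
    fix v assume "v \<in> fv t"
    with that bspec[OF N, of v] show "?s' (Var (q v)) = Var v" by (auto simp: q_def s_def s'_def)
  qed
  ultimately have "insert (Mem \<rho> K) \<Gamma> \<turnstile> \<beta>"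
    by (simp add: image_image UN_upper le_supI1 le_supI2 cong: image_cong)
  with mem show ?thesis by (rule cut_formula)
qed

lemma Mem_type: "\<Gamma> \<turnstile> Mem \<rho> K \<Longrightarrow> term_of L K (Pow C) \<Longrightarrow> term_of L \<rho> C"
  by (drule derives_wf(2)) (metis has_type_MemE has_type_unique ty.inject(2))

lemma Mem_pair_type:
  assumes "\<Gamma> \<turnstile> Mem (pair a b) K" "term_of L K (Pow (Prod [A, B]))"
  shows "term_of L a A" "term_of L b B"
  using Mem_type[OF assms] by (auto dest: has_type_pairE)

lemma s_set_is_type: "s_set L A X \<Longrightarrow> is_type L A"
  unfolding s_set_def using is_type is_type_PowE by blast

lemma describes_s_set: "describes K C vs \<sigma> \<alpha> \<Longrightarrow> s_set L C K"
  by (simp add: s_set_def describes_closed describes_type)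

lemma Mem_s_set_type: "s_set L A X \<Longrightarrow> has_type L Bs t A \<Longrightarrow> has_type L Bs (Mem t X) Omega"
  unfolding s_set_def by (auto intro: has_type.intros has_type_nil)

lemma s_set_univ_set: "is_type L A \<Longrightarrow> s_set L A (univ_set A)"
  using has_type_compr[of L "(0, A)" TT] by (simp add: s_set_def univ_set_def)

lemma univ_set_intro: "term_of L t A \<Longrightarrow> ctx \<Gamma> \<Longrightarrow> \<Gamma> \<turnstile> Mem t (univ_set A)"
  using Mem_compr[of TT t "(0, A)" \<Gamma>] by (simp add: univ_set_def Eq_TT_elim)

section \<open>Inclusions and composites\<close>

lemma describes_incl:
  assumes "s_set L A X"
  shows "describes (sgraph (incl A X)) (Prod [A, A]) {(0, A)}
    (pair (Var (0, A)) (Var (0, A))) (Mem (Var (0, A)) X)"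
proof -
  have v: "term_of L (Var (0, A)) A" using s_set_is_type[OF assms] by (simp add: has_type_Var)
  have "describes (compr_tm [(0, A)] (Prod [A, A]) (pair (Var (0, A)) (Var (0, A))) (Mem (Var (0, A)) X))
     (Prod [A, A]) (set [(0, A)]) (pair (Var (0, A)) (Var (0, A))) (Mem (Var (0, A)) X)"
    using v assms s_set_is_type[OF assms]
    by (intro describes_compr_tm has_type_pair Mem_s_set_type) (auto simp: s_set_def)
  then show ?thesis by (simp add: incl_def fun_of_term_def)
qed

lemma incl_intro:
  assumes X: "s_set L A X" and mem: "\<Gamma> \<turnstile> Mem a X"
  shows "\<Gamma> \<turnstile> Mem (pair a a) (sgraph (incl A X))"
proof -
  have "term_of L a A" using Mem_type[OF mem] X by (auto simp: s_set_def)
  then have "wt_env L (Var((0, A) := a))" by (simp add: wt_env_upd)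
  from describes_intro[OF describes_incl[OF X] this] mem X show ?thesis
    by (simp add: s_set_def msubst_closed)
qed

lemma incl_elim:
  assumes X: "s_set L A X" and mem: "\<Gamma> \<turnstile> Mem (pair a b) (sgraph (incl A X))"
  shows "\<Gamma> \<turnstile> Eq a b"
proof (rule describes_elim[OF describes_incl[OF X] mem finite.emptyI])
  have ty: "term_of L a A" "term_of L b A"
    using Mem_pair_type[OF mem] describes_type[OF describes_incl[OF X]] by auto
  then show "formula L (Eq a b)" by (rule has_type.intros)
  fix r :: "'g var \<Rightarrow> 'g var"
  assume r: "\<And>v. snd (r v) = snd v"
  let ?v = "Var (r (0, A))" and ?r = "msubst (\<lambda>v. Var (r v))"
  let ?\<Delta> = "insert (Eq (pair a b) (?r (pair (Var (0, A)) (Var (0, A))))) (insert (?r (Mem (Var (0, A)) X)) \<Gamma>)"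
  have "term_of L ?v A" using s_set_is_type[OF X] r[of "(0, A)"] by (simp add: has_type_Var)
  then have "ctx ?\<Delta>"
    using X derives_wf(1)[OF mem] ty
    by (auto simp: msubst_closed s_set_def intro: has_type.intros(8,9) has_type_pair)
  then have "?\<Delta> \<turnstile> Eq (pair a b) (pair ?v ?v)" by (intro assumption) auto
  from pair_inject[OF this] show "?\<Delta> \<turnstile> Eq a b" by (meson Eq_sym Eq_trans)
qed

text \<open>The comprehension binds \<open>x\<close> and \<open>z\<close>, whereas \<open>y\<close>
  is bound by a quantifier inside it. Counting all three as eigenvariables makes one elimination
  deliver the middle element as well.\<close>

lemma describes_s_comp:
  fixes A B C :: "'g ty"
  defines "x \<equiv> (0, A)" and "y \<equiv> (1, B)" and "z \<equiv> (2, C)"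
  assumes f: "s_set L (Prod [A, B]) (sgraph f)" and g: "s_set L (Prod [B, C]) (sgraph g)"
  shows "describes (sgraph (s_comp A B C g f)) (Prod [A, C]) {x, y, z} (pair (Var x) (Var z))
    (And (Mem (pair (Var x) (Var y)) (sgraph f)) (Mem (pair (Var y) (Var z)) (sgraph g)))"
proof -
  let ?\<sigma> = "pair (Var x) (Var z)"
  let ?\<alpha> = "And (Mem (pair (Var x) (Var y)) (sgraph f)) (Mem (pair (Var y) (Var z)) (sgraph g))"
  let ?K = "compr_tm [x, z] (Prod [A, C]) ?\<sigma> (Exists y ?\<alpha>)"
  have K: "sgraph (s_comp A B C g f) = ?K"
    by (simp add: s_comp_def x_def y_def z_def Let_def)
  have ty: "is_type L A" "is_type L B" "is_type L C"
    using s_set_is_type[OF f] s_set_is_type[OF g] by (auto elim!: is_type_ProdE)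
  then have v: "term_of L (Var x) A" "term_of L (Var y) B" "term_of L (Var z) C"
    by (auto simp: x_def y_def z_def intro!: has_type_Var)
  have \<alpha>: "formula L ?\<alpha>"
    using v by (intro has_type_And Mem_s_set_type[OF f] Mem_s_set_type[OF g] has_type_pair)
  have y: "is_type L (snd y)" using ty by (simp add: y_def)
  have D: "describes ?K (Prod [A, C]) (set [x, z]) ?\<sigma> (Exists y ?\<alpha>)"
  proof (rule describes_compr_tm)
    show "fv ?\<sigma> \<union> fv (Exists y ?\<alpha>) \<subseteq> set [x, z]" using f g by (auto simp: s_set_def)
    show "is_type L (snd v)" if "v \<in> set [x, z]" for v
      using that ty by (auto simp: x_def z_def)
  qed (use v \<alpha> y in \<open>auto intro: has_type_pair has_type_Exists\<close>)
  have "{?\<alpha>} \<turnstile> Exists y ?\<alpha>" by (rule Exists_intro[OF tautology[OF \<alpha>] y])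
  moreover have "{Exists y ?\<alpha>} \<turnstile> Mem ?\<sigma> ?K"
    using describes_intro[OF D wt_env_Var] tautology[OF has_type_Exists[OF y \<alpha>]] by simp
  ultimately have intro: "{?\<alpha>} \<turnstile> Mem ?\<sigma> ?K" by (rule cut1[rotated])
  have elim: "insert (Mem \<rho> ?K) \<Gamma> \<turnstile> \<beta>"
    if der: "insert (Eq \<rho> ?\<sigma>) (insert ?\<alpha> \<Gamma>) \<turnstile> \<beta>"
      and fresh: "{x, y, z} \<inter> (\<Union>(fv ` \<Gamma>) \<union> fv \<rho> \<union> fv \<beta>) = {}" for \<Gamma> \<rho> \<beta>
  proof -
    have "y \<noteq> x" "y \<noteq> z" by (simp_all add: x_def y_def z_def)
    then have "insert (Exists y ?\<alpha>) (insert (Eq \<rho> ?\<sigma>) \<Gamma>) \<turnstile> \<beta>"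
      using der fresh y by (intro Exists_left) (auto simp: insert_commute)
    then have "insert (Eq \<rho> ?\<sigma>) (insert (Exists y ?\<alpha>) \<Gamma>) \<turnstile> \<beta>" by (simp add: insert_commute)
    moreover have "set [x, z] \<inter> (\<Union>(fv ` \<Gamma>) \<union> fv \<rho> \<union> fv \<beta>) = {}" using fresh by auto
    ultimately show ?thesis by (rule describes_left[OF D])
  qed
  have "fv ?\<sigma> \<union> fv ?\<alpha> \<subseteq> {x, y, z}" using f g by (auto simp: s_set_def)
  with intro elim describes_closed[OF D] describes_type[OF D] show ?thesis
    unfolding K by (intro describesI) auto
qed

lemma s_comp_intro:
  assumes f: "s_set L (Prod [A, B]) (sgraph f)" and g: "s_set L (Prod [B, C]) (sgraph g)"
    and ab: "\<Gamma> \<turnstile> Mem (pair a b) (sgraph f)" and bc: "\<Gamma> \<turnstile> Mem (pair b c) (sgraph g)"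
  shows "\<Gamma> \<turnstile> Mem (pair a c) (sgraph (s_comp A B C g f))"
proof -
  have "term_of L a A" "term_of L b B" "term_of L c C"
    using Mem_pair_type[OF ab] Mem_pair_type[OF bc] f g by (auto simp: s_set_def)
  then have "wt_env L (Var((0, A) := a, (1, B) := b, (2, C) := c))" by (simp add: wt_env_upd)
  from describes_intro[OF describes_s_comp[OF f g] this] ab bc f g show ?thesis
    by (simp add: s_set_def msubst_closed And_intro)
qed

text \<open>Of the three copies supplied by \<open>describes_elim\<close>, those of \<open>x\<close>
  and \<open>z\<close> equal \<open>a\<close> and \<open>c\<close> because pairing is injective;
  only the middle element remains as an eigenvariable.\<close>

lemma s_comp_elim:
  assumes f: "s_set L (Prod [A, B]) (sgraph f)" and g: "s_set L (Prod [B, C]) (sgraph g)"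
    and mem: "\<Gamma> \<turnstile> Mem (pair a c) (sgraph (s_comp A B C g f))"
    and V: "finite V" and \<beta>: "formula L \<beta>"
    and step: "\<And>v. snd v = B \<Longrightarrow> v \<notin> V \<Longrightarrow>
      insert (Mem (pair a (Var v)) (sgraph f)) (insert (Mem (pair (Var v) c) (sgraph g)) \<Gamma>) \<turnstile> \<beta>"
  shows "\<Gamma> \<turnstile> \<beta>"
proof (rule describes_elim[OF describes_s_comp[OF f g] mem V \<beta>])
  let ?x = "(0, A)" and ?y = "(1, B)" and ?z = "(2, C)"
  fix r :: "'g var \<Rightarrow> 'g var"
  assume r: "\<And>v. snd (r v) = snd v" and rV: "range r \<inter> V = {}"
  let ?a = "Var (r ?x)" and ?b = "Var (r ?y)" and ?c = "Var (r ?z)" and ?r = "msubst (\<lambda>v. Var (r v))"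
  let ?\<Delta> = "insert (Eq (pair a c) (?r (pair (Var ?x) (Var ?z))))
    (insert (?r (And (Mem (pair (Var ?x) (Var ?y)) (sgraph f)) (Mem (pair (Var ?y) (Var ?z)) (sgraph g)))) \<Gamma>)"
  have d: "insert (Mem (pair a ?b) (sgraph f)) (insert (Mem (pair ?b c) (sgraph g)) \<Gamma>) \<turnstile> \<beta>"
    using r[of ?y] rV by (intro step) auto
  have ty: "is_type L A" "is_type L B" "is_type L C"
    using s_set_is_type[OF f] s_set_is_type[OF g] by (auto elim!: is_type_ProdE)
  have v: "term_of L ?a A" "term_of L ?b B" "term_of L ?c C"
    using ty r by (auto intro!: has_type_Var)
  have ac: "term_of L a A" "term_of L c C"
    using Mem_pair_type[OF mem] describes_type[OF describes_s_comp[OF f g]] by auto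
  have F: "?r (sgraph f) = sgraph f" "?r (sgraph g) = sgraph g" using f g by (auto simp: s_set_def msubst_closed)
  have c: "ctx ?\<Delta>"
    using v ac derives_wf(1)[OF mem]
    by (auto simp: F intro!: has_type_And Mem_s_set_type[OF f] Mem_s_set_type[OF g] has_type_pair
        has_type.intros(8)[of _ _ _ "Prod [A, C]"])
  have 1: "?\<Delta> \<turnstile> Eq (pair a c) (pair ?a ?c)" using c by (intro assumption) auto
  have "?\<Delta> \<turnstile> And (Mem (pair ?a ?b) (sgraph f)) (Mem (pair ?b ?c) (sgraph g))"
    using c by (intro assumption) (auto simp: F)
  note 2 = And_elim1[OF this] And_elim2[OF this]
  have 3: "?\<Delta> \<turnstile> Mem (pair a ?b) (sgraph f)"
    by (rule Mem_cong_left[OF pair_cong 2(1)]) (use pair_inject[OF 1] Eq_sym Eq_refl[OF v(2) c] in blast)+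
  have 4: "?\<Delta> \<turnstile> Mem (pair ?b c) (sgraph g)"
    by (rule Mem_cong_left[OF pair_cong 2(2)]) (use pair_inject[OF 1] Eq_sym Eq_refl[OF v(2) c] in blast)+
  show "?\<Delta> \<turnstile> \<beta>"
    by (rule cut_set[OF d _ c]) (use 3 4 c in \<open>auto intro: assumption\<close>)
qed

section \<open>Products\<close>

lemma describes_one_times:
  fixes Cs :: "'g ty list" and A B :: "'g ty"
  defines "us \<equiv> zip [0..<length Cs] Cs" and "x \<equiv> (length Cs, A)" and "y \<equiv> (Suc (length Cs), B)"
  assumes Cs: "\<forall>C \<in> set Cs. is_type L C" and g: "s_set L (Prod [A, B]) (sgraph g)"
  shows "describes (sgraph (one_times Cs A B g)) (Prod [prodT (Cs @ [A]), prodT (Cs @ [B])])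
    (set (us @ [x, y])) (pair (tuple (map Var (us @ [x]))) (tuple (map Var (us @ [y]))))
    (Mem (pair (Var x) (Var y)) (sgraph g))"
proof -
  have ty: "is_type L A" "is_type L B"
    using s_set_is_type[OF g] by (auto elim!: is_type_ProdE)
  have us: "map snd us = Cs" by (simp add: us_def)
  have xy: "snd x = A" "snd y = B" by (simp_all add: x_def y_def)
  have vs: "is_type L (snd v)" if "v \<in> set (us @ [x, y])" for v
    using that Cs ty us[symmetric] xy by auto
  have tup: "term_of L (tuple (map Var vs)) (prodT (map snd vs))" if "set vs \<subseteq> set (us @ [x, y])" for vs
    using that vs by (intro has_type_tuple) (auto simp: list_all2_conv_all_nth intro!: has_type_Var vs dest!: nth_mem)
  have v: "term_of L (Var x) A" "term_of L (Var y) B" using ty xy by (auto intro!: has_type_Var)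
  have "describes (compr_tm (us @ [x, y]) (Prod [prodT (Cs @ [A]), prodT (Cs @ [B])])
     (pair (tuple (map Var (us @ [x]))) (tuple (map Var (us @ [y]))))
     (Mem (pair (Var x) (Var y)) (sgraph g)))
     (Prod [prodT (Cs @ [A]), prodT (Cs @ [B])]) (set (us @ [x, y]))
     (pair (tuple (map Var (us @ [x]))) (tuple (map Var (us @ [y])))) (Mem (pair (Var x) (Var y)) (sgraph g))"
  proof (rule describes_compr_tm[OF vs])
    show "term_of L (pair (tuple (map Var (us @ [x]))) (tuple (map Var (us @ [y])))) (Prod [prodT (Cs @ [A]), prodT (Cs @ [B])])"
      using tup[of "us @ [x]"] tup[of "us @ [y]"] us xy by (intro has_type_pair) auto
    show "formula L (Mem (pair (Var x) (Var y)) (sgraph g))"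
      using v by (intro Mem_s_set_type[OF g] has_type_pair)
    show "fv (pair (tuple (map Var (us @ [x]))) (tuple (map Var (us @ [y]))) :: ('g, 'f) tm)
        \<union> fv (Mem (pair (Var x) (Var y)) (sgraph g)) \<subseteq> set (us @ [x, y])"
      using g by (auto simp: s_set_def)
  qed auto
  then show ?thesis by (simp add: one_times_def Let_def us_def x_def y_def)
qed

lemma one_times_intro:
  assumes ss: "list_all2 (term_of L) ss Cs" and g: "s_set L (Prod [A, B]) (sgraph g)"
    and mem: "\<Gamma> \<turnstile> Mem (pair a b) (sgraph g)"
  shows "\<Gamma> \<turnstile> Mem (pair (tuple (ss @ [a])) (tuple (ss @ [b]))) (sgraph (one_times Cs A B g))"
proof -
  let ?n = "length Cs"
  let ?us = "zip [0..<?n] Cs" and ?x = "(?n, A)" and ?y = "(Suc ?n, B)"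
  let ?vs = "?us @ [?x, ?y]"
  let ?e = "env_of ?vs (ss @ [a, b])"
  have ab: "term_of L a A" "term_of L b B"
    using Mem_pair_type[OF mem] g by (auto simp: s_set_def)
  have len: "length ss = length Cs" using ss by (rule list_all2_lengthD)
  have "wt_env L ?e"
    using ss ab by (intro wt_env_env_of) (simp add: list_all2_appendI)
  moreover have "distinct ?vs"
    by (auto simp: distinct_zipI1 dest: set_zip_leftD)
  then have "map ?e ?vs = ss @ [a, b]" using len by (intro map_env_of) auto
  then have e: "map ?e ?us = ss" "?e ?x = a" "?e ?y = b" using len by (auto simp: append_eq_append_conv)
  moreover have "\<forall>C \<in> set Cs. is_type L C"
    using ss is_type by (metis in_set_conv_nth list_all2_conv_all_nth)
  note describes_intro[OF describes_one_times[OF this g], of ?e \<Gamma>]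
  moreover have "msubst ?e (sgraph g) = sgraph g" using g by (simp add: s_set_def msubst_closed)
  ultimately show ?thesis using mem by (simp add: comp_def)
qed

text \<open>Comparing the left-hand tuples identifies the copies of the parameters with
  \<open>ss\<close> and the copy of the argument with \<open>a\<close>. Inserting this in the
  right-hand tuple shows that \<open>t\<close> has the same parameters.\<close>

lemma one_times_elim:
  assumes ss: "list_all2 (term_of L) ss Cs" and g: "s_set L (Prod [A, B]) (sgraph g)"
    and mem: "\<Gamma> \<turnstile> Mem (pair (tuple (ss @ [a])) t) (sgraph (one_times Cs A B g))"
    and a: "term_of L a A"
    and V: "finite V" and \<beta>: "formula L \<beta>"
    and step: "\<And>v. snd v = B \<Longrightarrow> v \<notin> V \<Longrightarrow>
      insert (Eq t (tuple (ss @ [Var v]))) (insert (Mem (pair a (Var v)) (sgraph g)) \<Gamma>) \<turnstile> \<beta>"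
  shows "\<Gamma> \<turnstile> \<beta>"
proof -
  let ?n = "length Cs"
  let ?us = "zip [0..<?n] Cs" and ?x = "(?n, A)" and ?y = "(Suc ?n, B)"
  have len: "length ss = length Cs" using ss by (rule list_all2_lengthD)
  have Cs: "\<forall>C \<in> set Cs. is_type L C"
    using ss is_type by (metis in_set_conv_nth list_all2_conv_all_nth)
  note D = describes_one_times[OF Cs g]
  have t: "term_of L t (prodT (Cs @ [B]))"
    using Mem_pair_type(2)[OF mem describes_type[OF D]] by simp
  have ty: "is_type L A" "is_type L B"
    using s_set_is_type[OF g] by (auto elim!: is_type_ProdE)
  show ?thesis
  proof (rule describes_elim[OF D mem V \<beta>])
    fix r :: "'g var \<Rightarrow> 'g var"
    assume r: "\<And>v. snd (r v) = snd v" and rV: "range r \<inter> V = {}"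
    let ?r = "msubst (\<lambda>v. Var (r v))"
    let ?ws = "map (\<lambda>v. Var (r v)) ?us" and ?a = "Var (r ?x)" and ?b = "Var (r ?y)"
    let ?\<Delta> = "insert (Eq (pair (tuple (ss @ [a])) t) (?r (pair (tuple (map Var (?us @ [?x]))) (tuple (map Var (?us @ [?y]))))))
      (insert (?r (Mem (pair (Var ?x) (Var ?y)) (sgraph g))) \<Gamma>)"
    have d: "insert (Eq t (tuple (ss @ [?b]))) (insert (Mem (pair a ?b) (sgraph g)) \<Gamma>) \<turnstile> \<beta>"
      using r[of ?y] rV by (intro step) auto
    have v: "term_of L ?a A" "term_of L ?b B" using ty r by (auto intro!: has_type_Var)
    have ws: "list_all2 (term_of L) ?ws Cs"
      using r Cs by (auto simp: list_all2_conv_all_nth intro!: has_type_Var)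
    have "ctx ?\<Delta>"
      using derives_wf(1)[OF mem] v ws ss a t g
      by (auto simp: comp_def s_set_def msubst_closed
          intro!: has_type.intros(8)[of _ _ _ "Prod [prodT (Cs @ [A]), prodT (Cs @ [B])]"]
            has_type.intros(9)[of _ _ _ "Prod [A, B]"] has_type_pair has_type_tuple list_all2_appendI)
    note c = this
    have 1: "?\<Delta> \<turnstile> Eq (pair (tuple (ss @ [a])) t) (pair (tuple (?ws @ [?a])) (tuple (?ws @ [?b])))"
      using c by (intro assumption) (auto simp: comp_def)
    have 2: "?\<Delta> \<turnstile> Eq ((ss @ [a]) ! i) ((?ws @ [?a]) ! i)" if "i < Suc ?n" for i
      using tuple_inject[OF pair_inject(1)[OF 1], of i] that len by simp
    have 3: "?\<Delta> \<turnstile> Mem (pair ?a ?b) (sgraph g)"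
      using c g by (intro assumption) (auto simp: s_set_def msubst_closed)
    \<comment> \<open>Index \<open>?n\<close> is the last position, since \<open>ss\<close> occupies
      exactly those below it.\<close>
    have 4: "?\<Delta> \<turnstile> Eq a ?a" using 2[of ?n] len by (simp add: nth_append)
    have "?\<Delta> \<turnstile> Mem (pair a ?b) (sgraph g)"
      by (rule Mem_cong_left[OF pair_cong[OF Eq_sym[OF 4] Eq_refl[OF v(2) c]] 3])
    moreover have "list_all2 (\<lambda>s t. ?\<Delta> \<turnstile> Eq s t) (?ws @ [?b]) (ss @ [?b])"
    proof (rule list_all2_appendI)
      show "list_all2 (\<lambda>s t. ?\<Delta> \<turnstile> Eq s t) ?ws ss"
        unfolding list_all2_conv_all_nth
      proof (intro conjI allI impI)
        fix i assume "i < length ?ws"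
        then show "?\<Delta> \<turnstile> Eq (?ws ! i) (ss ! i)"
          using 2[of i] len by (auto simp: nth_append intro: Eq_sym)
      qed (simp add: len)
    qed (use Eq_refl[OF v(2) c] in simp)
    from Eq_trans[OF pair_inject(2)[OF 1] tuple_cong[OF this c]]
    have "?\<Delta> \<turnstile> Eq t (tuple (ss @ [?b]))" .
    ultimately show "?\<Delta> \<turnstile> \<beta>"
      by (intro cut_set[OF d _ c]) (use c in \<open>auto intro: assumption\<close>)
  qed
qed

lemma fv_Conj: "fv (Conj \<alpha>s) = (\<Union>\<alpha> \<in> set \<alpha>s. fv \<alpha>)"
  by (induction \<alpha>s rule: Conj.induct) auto

lemma has_type_Conj: "(\<And>\<alpha>. \<alpha> \<in> set \<alpha>s \<Longrightarrow> formula L \<alpha>) \<Longrightarrow> formula L (Conj \<alpha>s)"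
  by (induction \<alpha>s rule: Conj.induct) (auto intro: has_type_And)

lemma msubst_Conj: "msubst e (Conj \<alpha>s) = Conj (map (msubst e) \<alpha>s)"
  by (induction \<alpha>s rule: Conj.induct) auto

lemma Conj_intro: "(\<And>\<alpha>. \<alpha> \<in> set \<alpha>s \<Longrightarrow> \<Gamma> \<turnstile> \<alpha>) \<Longrightarrow> ctx \<Gamma> \<Longrightarrow> \<Gamma> \<turnstile> Conj \<alpha>s"
  by (induction \<alpha>s rule: Conj.induct) (auto intro: TT_intro And_intro)

lemma describes_prod_set:
  fixes As :: "'g ty list"
  defines "xs \<equiv> zip [0..<length As] As"
  assumes "list_all2 (s_set L) As Xs"
  shows "describes (prod_set As Xs) (prodT As) (set xs) (tuple (map Var xs))
    (Conj (map2 (\<lambda>x X. Mem (Var x) X) xs Xs))"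
proof -
  have len: "length As = length Xs" using assms(2) by (rule list_all2_lengthD)
  have As: "is_type L A" if "A \<in> set As" for A
    using that assms(2) s_set_is_type by (auto simp: list_all2_conv_all_nth in_set_conv_nth)
  have xs: "is_type L (snd v)" if "v \<in> set xs" for v
    using that As[OF set_zip_rightD[of "fst v" "snd v"]] by (simp add: xs_def)
  have "list_all2 (term_of L) (map Var xs) As"
    using As by (auto simp: list_all2_conv_all_nth xs_def intro!: has_type_Var)
  then have "term_of L (tuple (map Var xs)) (prodT As)" by (rule has_type_tuple)
  moreover have mem: "formula L \<alpha> \<and> fv \<alpha> \<subseteq> set xs" if "\<alpha> \<in> set (map2 (\<lambda>x X. Mem (Var x) X) xs Xs)" for \<alpha>
  proof -
    from that obtain i where i: "i < length As" "\<alpha> = Mem (Var (i, As ! i)) (Xs ! i)"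
      using len by (auto simp: xs_def in_set_conv_nth)
    with assms(2) have X: "s_set L (As ! i) (Xs ! i)" by (simp add: list_all2_conv_all_nth)
    then have "formula L \<alpha>"
      using s_set_is_type[OF X] i by (auto intro!: Mem_s_set_type[OF X] has_type_Var)
    moreover have "(i, As ! i) \<in> set xs" using i by (auto simp: xs_def in_set_conv_nth)
    ultimately show ?thesis using X i by (simp add: s_set_def)
  qed
  ultimately show ?thesis
    unfolding prod_set_def Let_def xs_def[symmetric]
    using xs by (intro describes_compr_tm has_type_Conj) (auto simp only: fv_Conj fv_tuple set_map fv.simps)
qed

text \<open>Each conjunct defining the product is membership in a \<open>univ_set\<close>, which
  follows from the type alone. The terms \<open>ts\<close> also witness that the entries of
  \<open>As\<close> are types of the language.\<close>

lemma univ_prod_intro: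
  assumes ts: "list_all2 (term_of L) ts As" and "ctx \<Gamma>"
  shows "\<Gamma> \<turnstile> Mem (tuple ts) (prod_set As (map univ_set As))"
    and "s_set L (prodT As) (prod_set As (map univ_set As))"
proof -
  let ?xs = "zip [0..<length As] As"
  have len: "length ts = length As" using ts by (rule list_all2_lengthD)
  have X: "list_all2 (s_set L) As (map univ_set As)"
    using ts is_type by (auto simp: list_all2_conv_all_nth intro!: s_set_univ_set)
  note D = describes_prod_set[OF X]
  have "wt_env L (env_of ?xs ts)" using ts by (intro wt_env_env_of) simp
  moreover have e: "map (env_of ?xs ts) ?xs = ts" using len by (intro map_env_of) (auto simp: distinct_zipI1)
  moreover have "\<Gamma> \<turnstile> msubst (env_of ?xs ts) (Conj (map2 (\<lambda>x X. Mem (Var x) X) ?xs (map univ_set As)))"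
    unfolding msubst_Conj
  proof (rule Conj_intro[OF _ \<open>ctx \<Gamma>\<close>])
    fix \<alpha> assume "\<alpha> \<in> set (map (msubst (env_of ?xs ts)) (map2 (\<lambda>x X. Mem (Var x) X) ?xs (map univ_set As)))"
    then obtain i where i: "i < length As"
      and \<alpha>: "\<alpha> = Mem (env_of ?xs ts (?xs ! i)) (msubst (env_of ?xs ts) (univ_set (As ! i)))"
      by (auto simp: in_set_conv_nth)
    have "env_of ?xs ts (?xs ! i) = ts ! i" using e i len by (metis length_map nth_map)
    moreover have "fv (univ_set (As ! i) :: ('g, 'f) tm) = {}" by (simp add: univ_set_def)
    ultimately show "\<Gamma> \<turnstile> \<alpha>"
      using i ts \<open>ctx \<Gamma>\<close> by (auto simp: \<alpha> msubst_closed list_all2_conv_all_nth intro!: univ_set_intro)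
  qed
  ultimately show "\<Gamma> \<turnstile> Mem (tuple ts) (prod_set As (map univ_set As))"
    using describes_intro[OF D, of "env_of ?xs ts" \<Gamma>] by (simp add: comp_def)
  show "s_set L (prodT As) (prod_set As (map univ_set As))" by (rule describes_s_set[OF D])
qed

section \<open>Functional relations\<close>

text \<open>The names \<open>w\<close> and \<open>y'\<close> depend on how \<open>exp_set\<close>
  was formed, so only the properties needed to work with them are exported.\<close>

lemma s_function_unfold:
  assumes "s_function L S A B f"
  defines "F \<equiv> sgraph f" and "X \<equiv> sdom f" and "Y \<equiv> scod f"
  obtains w y' where "snd w = Prod [A, B]" "snd y' = B" "y' \<notin> {(1, A), (2, B)}"
    "{} \<turnstile> Forall w (Imp (Mem (Var w) F) (Mem (Var w) (prod_set [A, B] [X, Y])))"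
    "{} \<turnstile> Forall (1, A) (Imp (Mem (Var (1, A)) X)
       (Exists (2, B) (And (And (Mem (Var (2, B)) Y) (Mem (pair (Var (1, A)) (Var (2, B))) F))
         (Forall y' (Imp (And (Mem (Var y') Y) (Mem (pair (Var (1, A)) (Var y')) F))
           (Eq (Var (2, B)) (Var y')))))))"
proof -
  let ?u = "(0, Pow (Prod [A, B]))" and ?x = "(1, A)" and ?y = "(2, B)"
  let ?P = "prod_set [A, B] [X, Y]"
  let ?\<psi> = "And (Mem (Var ?y) Y) (Mem (pair (Var ?x) (Var ?y)) (Var ?u)) :: ('g, 'f) tm"
  have X: "s_set L A X" and Y: "s_set L B Y" and F: "s_set L (Prod [A, B]) F"
    and mem: "{} \<turnstile> Mem F (exp_set A B X Y)"
    using assms(1) unfolding s_function_def F_def X_def Y_def by auto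
  have closed: "fv X = {}" "fv Y = {}" "fv F = {}" using X Y F by (auto simp: s_set_def)
  have P: "s_set L (Prod [A, B]) ?P"
    using describes_s_set[OF describes_prod_set[of "[A, B]" "[X, Y]"]] X Y by simp
  then have cP: "fv ?P = {}" by (simp add: s_set_def)
  \<comment> \<open>These repeat the choices made by \<open>Subset\<close> and
    \<open>Exists1\<close> while the set variable \<open>?u\<close> is still free; the graph is put
    in for \<open>?u\<close> only afterwards.\<close>
  define w where "w = fresh_var (Prod [A, B]) (fv (Var ?u :: ('g, 'f) tm) \<union> fv ?P)"
  define y' where "y' = fresh_var B (insert ?y (fv ?\<psi>))"
  have w: "w \<notin> fv (Var ?u :: ('g, 'f) tm) \<union> fv ?P" "snd w = Prod [A, B]"
    unfolding w_def by (rule fresh_var; simp)+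
  have y': "y' \<notin> insert ?y (fv ?\<psi>)" "snd y' = B"
    unfolding y'_def by (rule fresh_var[of "insert ?y (fv ?\<psi>)"]; simp)+
  let ?\<phi> = "And (Forall w (Imp (Mem (Var w) (Var ?u)) (Mem (Var w) ?P)))
     (Forall ?x (Imp (Mem (Var ?x) X) (Exists ?y (And ?\<psi>
         (Forall y' (Imp (And (Mem (Var y') Y) (Mem (pair (Var ?x) (Var y')) (Var ?u)))
           (Eq (Var ?y) (Var y'))))))))"
  have exp: "exp_set A B X Y = compr ?u ?\<phi>"
  proof -
    have "subst ?y (Var y') Y = Y" using closed by (simp add: subst_eq_msubst msubst_closed)
    then have "subst ?y (Var y') ?\<psi> = And (Mem (Var y') Y) (Mem (pair (Var ?x) (Var y')) (Var ?u))"
      by (simp add: subst_eq_msubst)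
    then show ?thesis
      unfolding exp_set_def Subset_def Exists1_def Let_def snd_conv w_def[symmetric] y'_def[symmetric]
      by (simp only:)
  qed
  have ty: "is_type L A" "is_type L B" "is_type L (Prod [A, B])"
    using X Y F by (auto dest: s_set_is_type)
  have tv: "term_of L (Var ?u) (Pow (Prod [A, B]))" "term_of L (Var ?x) A" "term_of L (Var ?y) B"
    "term_of L (Var y') B" "term_of L (Var w) (Prod [A, B])"
    using ty w y' by (auto intro!: has_type_Var is_type.intros(4))
  have mem_u: "formula L (Mem s (Var ?u))" if "term_of L s (Prod [A, B])" for s
    using that tv(1) by (rule has_type.intros)
  have \<phi>: "formula L ?\<phi>"
    using ty tv w(2) y'(2)
    by (intro has_type_And has_type_Forall has_type_Imp has_type_Exists mem_u has_type_pair
        Mem_s_set_type[OF X] Mem_s_set_type[OF Y] Mem_s_set_type[OF P] has_type.intros(8)[of _ _ _ B]) auto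
  have "term_of L F (snd ?u)" using F by (simp add: s_set_def)
  from Mem_compr[OF \<phi> this, of "{}"] mem have "{} \<turnstile> msubst (Var(?u := F)) ?\<phi>"
    unfolding exp by (auto intro: Eq_mp)
  moreover have "msubst (Var(?u := F)) ?\<phi> =
     And (Forall w (Imp (Mem (Var w) F) (Mem (Var w) ?P)))
     (Forall ?x (Imp (Mem (Var ?x) X) (Exists ?y (And (And (Mem (Var ?y) Y) (Mem (pair (Var ?x) (Var ?y)) F))
         (Forall y' (Imp (And (Mem (Var y') Y) (Mem (pair (Var ?x) (Var y')) F))
           (Eq (Var ?y) (Var y'))))))))"
    using w y' closed cP by (simp add: msubst_Forall msubst_Exists msubst_closed)
  ultimately have "{} \<turnstile> And (Forall w (Imp (Mem (Var w) F) (Mem (Var w) ?P)))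
     (Forall ?x (Imp (Mem (Var ?x) X) (Exists ?y (And (And (Mem (Var ?y) Y) (Mem (pair (Var ?x) (Var ?y)) F))
         (Forall y' (Imp (And (Mem (Var y') Y) (Mem (pair (Var ?x) (Var y')) F))
           (Eq (Var ?y) (Var y'))))))))"
    by simp
  from that[OF w(2) y'(2) _ And_elim1[OF this] And_elim2[OF this]] y'(1) show thesis by simp
qed

lemma s_function_sets:
  assumes "s_function L S A B f"
  shows "s_set L A (sdom f)" "s_set L B (scod f)" "s_set L (Prod [A, B]) (sgraph f)"
  using assms by (auto simp: s_function_def)

text \<open>The inclusion of the graph in X \<times> Y, one half of membership in the exponential,
  is instantiated at the pair, and pairing is injective.\<close>

lemma s_function_mem:
  assumes f: "s_function L S A B f" and mem: "\<Gamma> \<turnstile> Mem (pair a b) (sgraph f)"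
  shows "\<Gamma> \<turnstile> Mem a (sdom f)" "\<Gamma> \<turnstile> Mem b (scod f)"
proof -
  note XY = s_function_sets[OF f]
  let ?P = "prod_set [A, B] [sdom f, scod f]"
  obtain w where w: "snd w = Prod [A, B]"
    and sub: "{} \<turnstile> Forall w (Imp (Mem (Var w) (sgraph f)) (Mem (Var w) ?P))"
    using s_function_unfold[OF f] by metis
  have "list_all2 (s_set L) [A, B] [sdom f, scod f]" using XY by simp
  note D = describes_prod_set[OF this]
  note P = describes_s_set[OF D, simplified]
  have vw: "term_of L (Var w) (Prod [A, B])" using s_set_is_type[OF XY(3)] w by (intro has_type_Var)
  have ab: "term_of L (pair a b) (Prod [A, B])" using Mem_type[OF mem] XY(3) by (simp add: s_set_def)
  have "{} \<turnstile> Imp (Mem (pair a b) (sgraph f)) (Mem (pair a b) ?P)"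
    using Forall_elim[OF sub, of "pair a b"] XY(3) P vw ab w
    by (simp add: has_type_Imp Mem_s_set_type) (simp add: s_set_def msubst_closed)
  then have P_ab: "\<Gamma> \<turnstile> Mem (pair a b) ?P"
    using Imp_elim[OF weaken0 mem] derives_wf(1)[OF mem] by blast
  have ty: "term_of L a A" "term_of L b B" using ab by (auto dest: has_type_pairE)
  have "\<Gamma> \<turnstile> And (Mem a (sdom f)) (Mem b (scod f))"
  proof (rule describes_elim[OF D P_ab finite.emptyI])
    show "formula L (And (Mem a (sdom f)) (Mem b (scod f)))"
      using ty XY by (intro has_type_And Mem_s_set_type)
    fix r :: "'g var \<Rightarrow> 'g var"
    assume r: "\<And>v. snd (r v) = snd v"
    let ?r = "msubst (\<lambda>v. Var (r v))" and ?xs = "zip [0..<length [A, B]] [A, B]"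
    let ?v = "Var (r (0, A))" and ?w = "Var (r (1, B))"
    let ?\<Delta> = "insert (Eq (pair a b) (?r (tuple (map Var ?xs))))
      (insert (?r (Conj (map2 (\<lambda>x X. Mem (Var x) X) ?xs [sdom f, scod f]))) \<Gamma>)"
    have \<Delta>: "?\<Delta> = insert (Eq (pair a b) (pair ?v ?w)) (insert (And (Mem ?v (sdom f)) (Mem ?w (scod f))) \<Gamma>)"
      using XY by (simp add: upt_rec s_set_def msubst_closed)
    have "term_of L ?v A" "term_of L ?w B"
      using XY r by (auto intro!: has_type_Var dest: s_set_is_type)
    then have c: "ctx ?\<Delta>"
      unfolding \<Delta> using ty derives_wf(1)[OF mem]
      by (auto intro!: has_type_And Mem_s_set_type[OF XY(1)] Mem_s_set_type[OF XY(2)] has_type_pair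
          has_type.intros(8)[of _ _ _ "Prod [A, B]"])
    have 1: "?\<Delta> \<turnstile> Eq (pair a b) (pair ?v ?w)"
      using c unfolding \<Delta> by (intro assumption) auto
    have 2: "?\<Delta> \<turnstile> And (Mem ?v (sdom f)) (Mem ?w (scod f))"
      using c unfolding \<Delta> by (intro assumption) auto
    show "?\<Delta> \<turnstile> And (Mem a (sdom f)) (Mem b (scod f))"
      using pair_inject[OF 1, THEN Eq_sym] And_elim1[OF 2] And_elim2[OF 2]
      by (intro And_intro) (auto intro: Mem_cong_left)
  qed
  then show "\<Gamma> \<turnstile> Mem a (sdom f)" "\<Gamma> \<turnstile> Mem b (scod f)" by (auto intro: And_elim1 And_elim2)
qed

text \<open>The value guaranteed by the exponential at the given argument equals each of
  \<open>b\<close> and \<open>c\<close>, hence they are equal.\<close>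

lemma s_function_unique:
  assumes f: "s_function L S A B f"
    and ab: "\<Gamma> \<turnstile> Mem (pair a b) (sgraph f)" and ac: "\<Gamma> \<turnstile> Mem (pair a c) (sgraph f)"
  shows "\<Gamma> \<turnstile> Eq b c"
proof -
  let ?F = "sgraph f" and ?X = "sdom f" and ?Y = "scod f" and ?x = "(1, A)" and ?y = "(2, B)"
  let ?\<psi> = "\<lambda>y. And (Mem y ?Y) (Mem (pair (Var ?x) y) ?F)"
  note XY = s_function_sets[OF f]
  obtain y' where y': "snd y' = B" "y' \<notin> {?x, ?y}"
    and ex: "{} \<turnstile> Forall ?x (Imp (Mem (Var ?x) ?X) (Exists ?y (And (?\<psi> (Var ?y))
         (Forall y' (Imp (?\<psi> (Var y')) (Eq (Var ?y) (Var y')))))))"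
    using s_function_unfold[OF f] by metis
  let ?\<chi> = "And (?\<psi> (Var ?y)) (Forall y' (Imp (?\<psi> (Var y')) (Eq (Var ?y) (Var y'))))"
  \<comment> \<open>\<open>?x\<close>, \<open>v\<close> and \<open>w\<close> stand in for
    \<open>a\<close>, \<open>b\<close> and \<open>c\<close>, since these terms and \<Gamma> may
    contain the bound variables \<open>?y\<close> and \<open>y'\<close>. The actual terms are
    inserted by one simultaneous substitution at the end.\<close>
  define v where "v = fresh_var B {?x, ?y, y'}"
  define w where "w = fresh_var B {?x, ?y, y', v}"
  have vw: "v \<notin> {?x, ?y, y'}" "w \<notin> {?x, ?y, y', v}" "snd v = B" "snd w = B"
    unfolding v_def w_def by (rule fresh_var; simp)+
  have ty: "is_type L A" "is_type L B" using XY by (auto dest: s_set_is_type)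
  have tv: "term_of L (Var ?x) A" "term_of L (Var ?y) B" "term_of L (Var y') B" "term_of L (Var v) B" "term_of L (Var w) B"
    using ty vw y' by (auto intro!: has_type_Var)
  have t\<psi>: "formula L (?\<psi> t)" if "term_of L t B" for t
    using that tv by (intro has_type_And Mem_s_set_type[OF XY(2)] Mem_s_set_type[OF XY(3)] has_type_pair)
  have t_imp: "formula L (Imp (?\<psi> (Var y')) (Eq (Var ?y) (Var y')))"
    using tv by (intro has_type_Imp t\<psi> has_type.intros(8)[of _ _ _ B])
  have t\<chi>: "formula L ?\<chi>" using tv t_imp ty y' by (intro has_type_And[OF t\<psi>] has_type_Forall) auto
  let ?\<Gamma> = "{Mem (pair (Var ?x) (Var v)) ?F, Mem (pair (Var ?x) (Var w)) ?F}"
  have c: "ctx ?\<Gamma>" using tv by (auto intro!: Mem_s_set_type[OF XY(3)] has_type_pair)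
  have xv: "?\<Gamma> \<turnstile> Mem (pair (Var ?x) (Var v)) ?F" "?\<Gamma> \<turnstile> Mem (pair (Var ?x) (Var w)) ?F"
    using c by (auto intro: assumption)
  have \<psi>vw: "?\<Gamma> \<turnstile> ?\<psi> (Var v)" "?\<Gamma> \<turnstile> ?\<psi> (Var w)"
    using xv s_function_mem(2)[OF f] by (auto intro!: And_intro)
  have "formula L (Imp (Mem (Var ?x) ?X) (Exists ?y ?\<chi>))"
    using t\<chi> tv ty by (intro has_type_Imp Mem_s_set_type[OF XY(1)] has_type_Exists) auto
  from Forall_elim[OF ex this, of "Var ?x"] tv have "{} \<turnstile> Imp (Mem (Var ?x) ?X) (Exists ?y ?\<chi>)"
    by (simp only: fun_upd_triv msubst_Var snd_conv)
  from Imp_elim[OF weaken0[OF this c] s_function_mem(1)[OF f xv(1)]]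
  have "?\<Gamma> \<turnstile> Exists ?y ?\<chi>" .
  moreover have "insert (Exists ?y ?\<chi>) ?\<Gamma> \<turnstile> Eq (Var v) (Var w)"
  proof (rule Exists_left)
    let ?\<Delta> = "insert ?\<chi> ?\<Gamma>"
    have c': "ctx ?\<Delta>" using c t\<chi> by simp
    have "?\<Delta> \<turnstile> ?\<chi>" using c' by (intro assumption) auto
    note all = Forall_elim[OF And_elim2[OF this] t_imp]
    have eq: "?\<Delta> \<turnstile> Eq (Var ?y) (Var t)" if "?\<Gamma> \<turnstile> ?\<psi> (Var t)" "term_of L (Var t) B" for t
    proof -
      have "msubst (Var(y' := Var t)) ?Y = ?Y" "msubst (Var(y' := Var t)) ?F = ?F"
        using XY by (auto simp: s_set_def msubst_closed)
      moreover have "?x \<noteq> y'" "?y \<noteq> y'" using y' by auto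
      ultimately have "?\<Delta> \<turnstile> Imp (?\<psi> (Var t)) (Eq (Var ?y) (Var t))"
        using all[of "Var t"] that y'(1) by simp
      then show ?thesis by (rule Imp_elim) (use that c' in \<open>auto elim!: weaken\<close>)
    qed
    show "?\<Delta> \<turnstile> Eq (Var v) (Var w)"
      using eq[OF \<psi>vw(1) tv(4)] eq[OF \<psi>vw(2) tv(5)] by (meson Eq_sym Eq_trans)
  qed (use ty vw XY in \<open>auto simp: s_set_def\<close>)
  ultimately have "?\<Gamma> \<turnstile> Eq (Var v) (Var w)" by (rule cut_formula)
  moreover have "term_of L a A" "term_of L b B" "term_of L c B"
    using Mem_pair_type[OF ab] Mem_pair_type[OF ac] XY(3) by (auto simp: s_set_def)
  then have "wt_env L (Var(?x := a, v := b, w := c))" using vw by (simp add: wt_env_upd)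
  ultimately have "msubst (Var(?x := a, v := b, w := c)) ` ?\<Gamma> \<turnstile> msubst (Var(?x := a, v := b, w := c)) (Eq (Var v) (Var w))"
    by (rule derives_msubst)
  moreover have "v \<noteq> w" "?x \<noteq> v" "?x \<noteq> w" using vw by auto
  ultimately have "{Mem (pair a b) ?F, Mem (pair a c) ?F} \<turnstile> Eq b c"
    using XY by (simp add: s_set_def msubst_closed)
  then show ?thesis using ab ac by (rule cut2)
qed

section \<open>The preimage translation\<close>

lemma describes_formula_graph:
  fixes vs :: "'g var list" and \<theta> :: "('g, 'f) tm"
  defines "U \<equiv> prod_set (map snd vs) (map univ_set (map snd vs))"
  assumes vs: "\<forall>v \<in> set vs. is_type L (snd v)" and \<theta>: "formula L \<theta>" "fv \<theta> \<subseteq> set vs"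
  shows "describes (sgraph (fun_of_term vs Omega \<theta> U (univ_set Omega)))
    (Prod [prodT (map snd vs), Omega]) (set vs) (pair (tuple (map Var vs)) \<theta>) (Mem (tuple (map Var vs)) U)"
proof -
  have l: "list_all2 (term_of L) (map Var vs) (map snd vs)"
    using wt_env_Var vs by (rule wt_env_list)
  have U: "s_set L (prodT (map snd vs)) U" unfolding U_def by (rule univ_prod_intro(2)[OF l ctx_simps(1)])
  have t: "term_of L (tuple (map Var vs)) (prodT (map snd vs))" using l by (rule has_type_tuple)
  show ?thesis unfolding fun_of_term_def sgraph.simps
    using vs \<theta> U t by (intro describes_compr_tm has_type_pair Mem_s_set_type[OF U]) (auto simp: s_set_def)
qed

text \<open>The graph pairs the tuple with the instance of \<theta>; once that instance is
  derivable, it equals \<open>TT\<close>.\<close>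

lemma formula_graph_intro:
  assumes vs: "\<forall>v \<in> set vs. is_type L (snd v)" and \<theta>: "formula L \<theta>" "fv \<theta> \<subseteq> set vs"
    and e: "wt_env L e" and der: "\<Gamma> \<turnstile> msubst e \<theta>"
  shows "\<Gamma> \<turnstile> Mem (pair (tuple (map e vs)) TT)
    (sgraph (fun_of_term vs Omega \<theta> (prod_set (map snd vs) (map univ_set (map snd vs))) (univ_set Omega)))"
proof -
  let ?U = "prod_set (map snd vs) (map univ_set (map snd vs)) :: ('g, 'f) tm"
  note c = derives_wf(1)[OF der]
  have l: "list_all2 (term_of L) (map e vs) (map snd vs)"
    using e vs by (rule wt_env_list)
  have U: "fv ?U = {}" using univ_prod_intro(2)[OF l c] by (simp add: s_set_def)
  note describes_intro[OF describes_formula_graph[OF vs \<theta>] e, of \<Gamma>]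
  with univ_prod_intro(1)[OF l c] U
  have 1: "\<Gamma> \<turnstile> Mem (pair (tuple (map e vs)) (msubst e \<theta>)) (sgraph (fun_of_term vs Omega \<theta> ?U (univ_set Omega)))"
    by (simp add: comp_def msubst_closed)
  have "\<Gamma> \<turnstile> Eq (pair (tuple (map e vs)) (msubst e \<theta>)) (pair (tuple (map e vs)) TT)"
    by (rule pair_cong[OF Eq_refl[OF has_type_tuple[OF l] c] Eq_TT_intro[OF der]])
  from Mem_cong_left[OF this 1] show ?thesis .
qed

text \<open>Injectivity equates the copy of each variable in \<open>vs\<close> with its value under
  \<open>e\<close>, and the renamed \<theta> with \<open>TT\<close>. Since the free variables of
  \<theta> lie in \<open>vs\<close>, \<open>leibniz_env\<close> carries the renamed formula over to
  \<open>e\<close>.\<close>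

lemma formula_graph_elim:
  assumes vs: "\<forall>v \<in> set vs. is_type L (snd v)" and \<theta>: "formula L \<theta>" "fv \<theta> \<subseteq> set vs"
    and e: "wt_env L e"
    and mem: "\<Gamma> \<turnstile> Mem (pair (tuple (map e vs)) TT)
      (sgraph (fun_of_term vs Omega \<theta> (prod_set (map snd vs) (map univ_set (map snd vs))) (univ_set Omega)))"
  shows "\<Gamma> \<turnstile> msubst e \<theta>"
proof (rule describes_elim[OF describes_formula_graph[OF vs \<theta>] mem finite.emptyI])
  show "formula L (msubst e \<theta>)" using \<theta>(1) e by (rule has_type_msubst)
  let ?U = "prod_set (map snd vs) (map univ_set (map snd vs)) :: ('g, 'f) tm"
  fix r :: "'g var \<Rightarrow> 'g var"
  assume r: "\<And>v. snd (r v) = snd v"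
  let ?e = "\<lambda>v. Var (r v)"
  let ?\<Delta> = "insert (Eq (pair (tuple (map e vs)) TT) (msubst ?e (pair (tuple (map Var vs)) \<theta>)))
    (insert (msubst ?e (Mem (tuple (map Var vs)) ?U)) \<Gamma>)"
  have r': "wt_env L (?e :: 'g var \<Rightarrow> ('g, 'f) tm)" using r by (rule wt_env_rename)
  have l: "list_all2 (term_of L) (map e vs) (map snd vs)"
    if "wt_env L e" for e :: "'g var \<Rightarrow> ('g, 'f) tm"
    using that vs by (rule wt_env_list)
  have U: "s_set L (prodT (map snd vs)) ?U" by (rule univ_prod_intro(2)[OF l[OF e] ctx_simps(1)])
  have c: "ctx ?\<Delta>"
    using derives_wf(1)[OF mem] U has_type_msubst[OF \<theta>(1) r'] l[OF r'] l[OF e]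
    by (auto simp: comp_def s_set_def msubst_closed intro!: has_type_tuple has_type_pair
        has_type.intros(8)[of _ _ _ "Prod [prodT (map snd vs), Omega]"] has_type.intros(9)[of _ _ _ "prodT (map snd vs)"])
  have 1: "?\<Delta> \<turnstile> Eq (pair (tuple (map e vs)) TT) (pair (tuple (map ?e vs)) (msubst ?e \<theta>))"
    using c by (intro assumption) (auto simp: comp_def)
  have eq: "?\<Delta> \<turnstile> Eq (?e v) (e v)" if "v \<in> fv \<theta>" for v
  proof -
    from that \<theta>(2) obtain i where "i < length vs" "v = vs ! i" by (metis in_set_conv_nth subsetD)
    with tuple_inject[OF pair_inject(1)[OF 1], of i] show ?thesis by (simp add: Eq_sym)
  qed
  have "?\<Delta> \<turnstile> msubst ?e \<theta>" by (rule Eq_TT_elim[OF Eq_sym[OF pair_inject(2)[OF 1]]])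
  from leibniz_env[OF _ r' e this \<theta>(1)] eq show "?\<Delta> \<turnstile> msubst e \<theta>" .
qed

section \<open>Introduction and elimination rules for the translation\<close>

context
  fixes A B :: "'g ty" and f :: "('g, 'f) sfun" and x y :: "'g var"
  assumes f: "s_function L S A B f" and x: "snd x = A" and y: "snd y = B"
begin

lemma is_type_AB: "is_type L A" "is_type L B"
  using s_function_sets[OF f] by (auto dest: s_set_is_type)

text \<open>The domain is written through \<open>map snd (xs @ [y])\<close>, the shape in which the
  rules for formula graphs are stated.\<close>

definition formula_fun :: "'g var list \<Rightarrow> ('g, 'f) tm \<Rightarrow> ('g, 'f) sfun" where
  "formula_fun xs \<theta> = fun_of_term (xs @ [y]) Omega \<theta>
     (prod_set (map snd (xs @ [y])) (map univ_set (map snd (xs @ [y])))) (univ_set Omega)"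

text \<open>This is the inner composite, the map of \<theta> after 1 \<times> i_Y. Isolating it
  splits the translation into two composites, each with its own elimination.\<close>

definition restricted_fun :: "'g var list \<Rightarrow> ('g, 'f) tm \<Rightarrow> ('g, 'f) sfun" where
  "restricted_fun xs \<theta> = s_comp (prodT (map snd xs @ [B])) (prodT (map snd xs @ [B])) Omega
     (formula_fun xs \<theta>) (one_times (map snd xs) B B (incl B (scod f)))"

lemma preimage_eq:
  "preimage xs x y f \<theta> = Mem (pair (tuple (map Var xs @ [Var x])) TT)
     (sgraph (s_comp (prodT (map snd xs @ [A])) (prodT (map snd xs @ [B])) Omega
        (restricted_fun xs \<theta>) (one_times (map snd xs) A B f)))"
  by (simp add: preimage_def natural_def Let_def x y restricted_fun_def formula_fun_def)

context
  fixes xs :: "'g var list" and \<theta> :: "('g, 'f) tm"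
  assumes \<theta>: "formula L \<theta>" and vc: "var_context L xs y \<theta>"
begin

lemma preimage_context:
  "\<forall>v \<in> set (xs @ [y]). is_type L (snd v)" "fv \<theta> \<subseteq> set (xs @ [y])" "y \<notin> set xs"
  using vc is_type_AB y by (auto simp: var_context_def)

lemma parameters: "list_all2 (term_of L) (map Var xs) (map snd xs)"
  by (rule wt_env_list) (use preimage_context in auto)

lemma s_set_one_times:
  "s_set L (Prod [C, D]) (sgraph g) \<Longrightarrow>
   s_set L (Prod [prodT (map snd xs @ [C]), prodT (map snd xs @ [D])]) (sgraph (one_times (map snd xs) C D g))"
  by (rule describes_s_set[OF describes_one_times]) (use preimage_context in auto)

lemma s_set_incl: "s_set L (Prod [B, B]) (sgraph (incl B (scod f)))"
  by (rule describes_s_set[OF describes_incl[OF s_function_sets(2)[OF f]]])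

lemma s_set_formula_fun: "s_set L (Prod [prodT (map snd xs @ [B]), Omega]) (sgraph (formula_fun xs \<theta>))"
  using describes_s_set[OF describes_formula_graph[OF preimage_context(1) \<theta> preimage_context(2)]]
  by (simp add: formula_fun_def y)

lemma s_set_restricted_fun: "s_set L (Prod [prodT (map snd xs @ [B]), Omega]) (sgraph (restricted_fun xs \<theta>))"
  unfolding restricted_fun_def
  by (rule describes_s_set[OF describes_s_comp[OF s_set_one_times[OF s_set_incl] s_set_formula_fun]])

text \<open>Distinctness of the variable list keeps \<open>y\<close> out of \<open>xs\<close>, so
  the instance changes only the last component.\<close>

lemma instance_env:
  assumes "term_of L b B"
  shows "wt_env L (Var(y := b))" "map (Var(y := b)) (xs @ [y]) = map Var xs @ [b]"
  using assms preimage_context(3) y by (auto intro: wt_env_upd)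

lemma restricted_fun_intro:
  assumes b: "\<Gamma> \<turnstile> Mem b (scod f)" and der: "\<Gamma> \<turnstile> msubst (Var(y := b)) \<theta>"
  shows "\<Gamma> \<turnstile> Mem (pair (tuple (map Var xs @ [b])) TT) (sgraph (restricted_fun xs \<theta>))"
proof -
  have tb: "term_of L b B" using Mem_type[OF b] s_function_sets(2)[OF f] by (simp add: s_set_def)
  \<comment> \<open>An inclusion relates \<open>b\<close> to itself, so the middle element of the
    composite is the same tuple.\<close>
  have "\<Gamma> \<turnstile> Mem (pair (tuple (map Var xs @ [b])) (tuple (map Var xs @ [b])))
      (sgraph (one_times (map snd xs) B B (incl B (scod f))))"
    by (rule one_times_intro[OF parameters s_set_incl incl_intro[OF s_function_sets(2)[OF f] b]])
  moreover have "\<Gamma> \<turnstile> Mem (pair (tuple (map Var xs @ [b])) TT) (sgraph (formula_fun xs \<theta>))"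
    using formula_graph_intro[OF preimage_context(1) \<theta> preimage_context(2) instance_env(1)[OF tb] der]
    unfolding formula_fun_def instance_env(2)[OF tb] .
  ultimately show ?thesis
    unfolding restricted_fun_def by (rule s_comp_intro[OF s_set_one_times[OF s_set_incl] s_set_formula_fun])
qed

lemma restricted_fun_elim:
  assumes tb: "term_of L b B"
    and mem: "\<Gamma> \<turnstile> Mem (pair (tuple (map Var xs @ [b])) TT) (sgraph (restricted_fun xs \<theta>))"
  shows "\<Gamma> \<turnstile> msubst (Var(y := b)) \<theta>"
proof (rule s_comp_elim[OF s_set_one_times[OF s_set_incl] s_set_formula_fun mem[unfolded restricted_fun_def] finite.emptyI])
  let ?G = "sgraph (one_times (map snd xs) B B (incl B (scod f)))" and ?H = "sgraph (formula_fun xs \<theta>)"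
  let ?CB = "prodT (map snd xs @ [B])"
  show t\<theta>: "formula L (msubst (Var(y := b)) \<theta>)" by (rule has_type_msubst[OF \<theta> instance_env(1)[OF tb]])
  fix t :: "'g var"
  assume t: "snd t = ?CB"
  let ?\<Gamma> = "insert (Mem (pair (tuple (map Var xs @ [b])) (Var t)) ?G) (insert (Mem (pair (Var t) TT) ?H) \<Gamma>)"
  have tup: "term_of L (tuple (map Var xs @ [c])) ?CB" if "term_of L c B" for c
    using that parameters by (intro has_type_tuple list_all2_appendI) auto
  have vt: "term_of L (Var t) ?CB" using is_type[OF tup[OF tb]] t by (intro has_type_Var)
  have c: "ctx ?\<Gamma>"
    using derives_wf(1)[OF mem] tup[OF tb] vt
    by (auto intro!: Mem_s_set_type[OF s_set_one_times[OF s_set_incl]] Mem_s_set_type[OF s_set_formula_fun] has_type_pair)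
  show "?\<Gamma> \<turnstile> msubst (Var(y := b)) \<theta>"
  proof (rule one_times_elim[OF parameters s_set_incl _ tb finite.emptyI t\<theta>])
    show "?\<Gamma> \<turnstile> Mem (pair (tuple (map Var xs @ [b])) (Var t)) ?G" using c by (intro assumption) auto
    fix v :: "'g var"
    assume v: "snd v = B"
    let ?\<Delta> = "insert (Eq (Var t) (tuple (map Var xs @ [Var v]))) (insert (Mem (pair b (Var v)) (sgraph (incl B (scod f)))) ?\<Gamma>)"
    have tv: "term_of L (Var v) B" using is_type_AB v by (intro has_type_Var)
    have c': "ctx ?\<Delta>"
      using c vt tb tv tup[OF tv] by (auto intro!: Mem_s_set_type[OF s_set_incl] has_type_pair intro: has_type.intros(8))
    have 1: "?\<Delta> \<turnstile> Eq (Var t) (tuple (map Var xs @ [Var v]))"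
      and 2: "?\<Delta> \<turnstile> Mem (pair b (Var v)) (sgraph (incl B (scod f)))"
      and 3: "?\<Delta> \<turnstile> Mem (pair (Var t) TT) ?H"
      using c' by (intro assumption; simp)+
    have "?\<Delta> \<turnstile> Mem (pair (tuple (map Var xs @ [Var v])) TT) ?H"
      by (rule Mem_cong_left[OF pair_cong[OF 1 Eq_refl[OF has_type_TT c']] 3])
    then have "?\<Delta> \<turnstile> msubst (Var(y := Var v)) \<theta>"
      unfolding formula_fun_def instance_env(2)[OF tv, symmetric]
      by (rule formula_graph_elim[OF preimage_context(1) \<theta> preimage_context(2) instance_env(1)[OF tv]])
    moreover have "?\<Delta> \<turnstile> Eq (Var v) b" by (rule Eq_sym[OF incl_elim[OF s_function_sets(2)[OF f] 2]])
    ultimately show "?\<Delta> \<turnstile> msubst (Var(y := b)) \<theta>"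
      using leibniz[OF _ _ \<theta> wt_env_Var, of ?\<Delta> "Var v" b y] tv y by simp
  qed
qed

lemma preimage_formula: "formula L (preimage xs x y f \<theta>)"
proof -
  have "term_of L (tuple (map Var xs @ [Var x])) (prodT (map snd xs @ [A]))"
    using parameters is_type_AB x by (intro has_type_tuple list_all2_appendI) (auto intro: has_type_Var)
  then show ?thesis
    unfolding preimage_eq
    by (intro Mem_s_set_type[OF describes_s_set[OF describes_s_comp]] has_type_pair has_type_TT
        s_set_one_times s_set_restricted_fun s_function_sets(3)[OF f])
qed

text \<open>Beyond the condition \<open>var_context\<close>, the premises do not involve
  \<open>xs\<close>. Together with \<open>preimage_elim\<close> this makes translations formed with
  different parameter lists comparable.\<close>

lemma preimage_intro:
  assumes xb: "\<Gamma> \<turnstile> Mem (pair (Var x) b) (sgraph f)" and der: "\<Gamma> \<turnstile> msubst (Var(y := b)) \<theta>"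
  shows "\<Gamma> \<turnstile> preimage xs x y f \<theta>"
  unfolding preimage_eq
  by (rule s_comp_intro[OF s_set_one_times[OF s_function_sets(3)[OF f]] s_set_restricted_fun
      one_times_intro[OF parameters s_function_sets(3)[OF f] xb]
      restricted_fun_intro[OF s_function_mem(2)[OF f xb] der]])

text \<open>The two composites are opened one after the other. The variable \<open>v\<close> comes
  without a freshness guarantee; it serves below only as a witness for
  \<open>preimage_intro\<close>, where any term is admissible.\<close>

lemma preimage_elim:
  assumes mem: "\<Gamma> \<turnstile> preimage xs x y f \<theta>" and \<beta>: "formula L \<beta>"
    and step: "\<And>v. snd v = B \<Longrightarrow>
      insert (Mem (pair (Var x) (Var v)) (sgraph f)) (insert (msubst (Var(y := Var v)) \<theta>) \<Gamma>) \<turnstile> \<beta>"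
  shows "\<Gamma> \<turnstile> \<beta>"
proof (rule s_comp_elim[OF s_set_one_times[OF s_function_sets(3)[OF f]] s_set_restricted_fun
      mem[unfolded preimage_eq] finite.emptyI \<beta>])
  let ?CA = "prodT (map snd xs @ [A])" and ?CB = "prodT (map snd xs @ [B])"
  let ?G = "sgraph (one_times (map snd xs) A B f)" and ?R = "sgraph (restricted_fun xs \<theta>)"
  fix t :: "'g var"
  assume t: "snd t = ?CB"
  let ?\<Gamma> = "insert (Mem (pair (tuple (map Var xs @ [Var x])) (Var t)) ?G) (insert (Mem (pair (Var t) TT) ?R) \<Gamma>)"
  have tx: "term_of L (Var x) A" using is_type_AB x by (intro has_type_Var)
  have tup: "term_of L (tuple (map Var xs @ [c])) (prodT (map snd xs @ [C]))" if "term_of L c C" for c C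
    using that parameters by (intro has_type_tuple list_all2_appendI) auto
  have "is_type L ?CB"
    using s_set_is_type[OF s_set_restricted_fun] by (auto elim: is_type_ProdE)
  then have vt: "term_of L (Var t) ?CB" using t by (intro has_type_Var)
  have c: "ctx ?\<Gamma>"
    using derives_wf(1)[OF mem] tup[OF tx] vt
    by (auto intro!: Mem_s_set_type[OF s_set_one_times[OF s_function_sets(3)[OF f]]]
        Mem_s_set_type[OF s_set_restricted_fun] has_type_pair)
  show "?\<Gamma> \<turnstile> \<beta>"
  proof (rule one_times_elim[OF parameters s_function_sets(3)[OF f] _ tx finite.emptyI \<beta>])
    show "?\<Gamma> \<turnstile> Mem (pair (tuple (map Var xs @ [Var x])) (Var t)) ?G" using c by (intro assumption) auto
    fix v :: "'g var"
    assume v: "snd v = B"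
    let ?\<Delta> = "insert (Eq (Var t) (tuple (map Var xs @ [Var v]))) (insert (Mem (pair (Var x) (Var v)) (sgraph f)) ?\<Gamma>)"
    have tv: "term_of L (Var v) B" using is_type_AB v by (intro has_type_Var)
    have c': "ctx ?\<Delta>"
      using c vt tx tv tup[OF tv]
      by (auto intro!: Mem_s_set_type[OF s_function_sets(3)[OF f]] has_type_pair intro: has_type.intros(8))
    have 1: "?\<Delta> \<turnstile> Eq (Var t) (tuple (map Var xs @ [Var v]))"
      and 2: "?\<Delta> \<turnstile> Mem (pair (Var t) TT) ?R"
      using c' by (intro assumption; simp)+
    have "?\<Delta> \<turnstile> Mem (pair (tuple (map Var xs @ [Var v])) TT) ?R"
      by (rule Mem_cong_left[OF pair_cong[OF 1 Eq_refl[OF has_type_TT c']] 2])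
    then have "?\<Delta> \<turnstile> msubst (Var(y := Var v)) \<theta>" by (rule restricted_fun_elim[OF tv])
    then show "?\<Delta> \<turnstile> \<beta>"
      by (intro cut_set[OF step[OF v] _ c']) (use c' in \<open>auto intro: assumption\<close>)
  qed
qed

end

section \<open>Compatibility of the translation with conjunction and disjunction\<close>

lemma graph_formula:
  assumes "snd v = B"
  shows "formula L (Mem (pair (Var x) (Var v)) (sgraph f))"
  using has_type_Var[OF is_type_AB(1) x] has_type_Var[OF is_type_AB(2) assms]
  by (intro Mem_s_set_type[OF s_function_sets(3)[OF f]] has_type_pair)

lemma instance_formula:
  assumes "snd v = B" "formula L \<alpha>"
  shows "formula L (msubst (Var(y := Var v)) \<alpha>)"
  using has_type_Var[OF is_type_AB(2) assms(1)] assms(2) y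
  by (intro has_type_msubst wt_env_upd wt_env_Var) simp_all

lemma preimage_And:
  assumes \<theta>: "formula L \<theta>" "var_context L xs y \<theta>" and \<gamma>: "formula L \<gamma>" "var_context L ys y \<gamma>"
    and vc: "var_context L zs y (And \<theta> \<gamma>)"
  shows "{} \<turnstile> Eq (preimage zs x y f (And \<theta> \<gamma>)) (And (preimage xs x y f \<theta>) (preimage ys x y f \<gamma>))"
proof -
  let ?F = "sgraph f" and ?P = "preimage xs x y f \<theta>" and ?Q = "preimage ys x y f \<gamma>"
    and ?R = "preimage zs x y f (And \<theta> \<gamma>)"
  let ?s = "\<lambda>v. msubst (Var(y := Var v))"
  have \<theta>\<gamma>: "formula L (And \<theta> \<gamma>)" using \<theta>(1) \<gamma>(1) by (rule has_type_And)
  note forms = preimage_formula[OF \<theta>] preimage_formula[OF \<gamma>] preimage_formula[OF \<theta>\<gamma> vc]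
  show ?thesis
  proof (rule equivalence)
    show "{?R} \<turnstile> And ?P ?Q"
    proof (rule preimage_elim[OF \<theta>\<gamma> vc tautology[OF forms(3)] has_type_And[OF forms(1,2)]])
      fix v :: "'g var"
      assume v: "snd v = B"
      let ?\<Delta> = "{Mem (pair (Var x) (Var v)) ?F, ?s v (And \<theta> \<gamma>), ?R}"
      have c: "ctx ?\<Delta>" using graph_formula[OF v] instance_formula[OF v \<theta>\<gamma>] forms by simp
      have 1: "?\<Delta> \<turnstile> Mem (pair (Var x) (Var v)) ?F" and 2: "?\<Delta> \<turnstile> And (?s v \<theta>) (?s v \<gamma>)"
        using c by (intro assumption; simp)+
      show "?\<Delta> \<turnstile> And ?P ?Q"
        by (intro And_intro preimage_intro[OF \<theta> 1] preimage_intro[OF \<gamma> 1] And_elim1[OF 2] And_elim2[OF 2])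
    qed
    have PQ: "formula L (And ?P ?Q)" using forms by (intro has_type_And)
    show "{And ?P ?Q} \<turnstile> ?R"
    proof (rule preimage_elim[OF \<theta> And_elim1[OF tautology[OF PQ]] forms(3)])
      fix v :: "'g var"
      assume v: "snd v = B"
      let ?\<Delta> = "{Mem (pair (Var x) (Var v)) ?F, ?s v \<theta>, And ?P ?Q}"
      have c: "ctx ?\<Delta>" using graph_formula[OF v] instance_formula[OF v \<theta>(1)] PQ by simp
      have "?\<Delta> \<turnstile> And ?P ?Q" using c by (intro assumption) auto
      then show "?\<Delta> \<turnstile> ?R"
      proof (rule preimage_elim[OF \<gamma> And_elim2 forms(3)])
        fix w :: "'g var"
        assume w: "snd w = B"
        let ?\<Theta> = "insert (Mem (pair (Var x) (Var w)) ?F) (insert (?s w \<gamma>) ?\<Delta>)"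
        have c': "ctx ?\<Theta>" using c graph_formula[OF w] instance_formula[OF w \<gamma>(1)] by simp
        have 1: "?\<Theta> \<turnstile> Mem (pair (Var x) (Var v)) ?F" and 2: "?\<Theta> \<turnstile> Mem (pair (Var x) (Var w)) ?F"
          and 3: "?\<Theta> \<turnstile> ?s v \<theta>" and 4: "?\<Theta> \<turnstile> ?s w \<gamma>"
          using c' by (intro assumption; simp)+
        \<comment> \<open>The two eliminations give values \<open>v\<close> and \<open>w\<close> of
          \<open>f\<close> at \<open>x\<close>; their equality moves \<gamma> from \<open>w\<close>
          to \<open>v\<close>, where \<theta> already holds.\<close>
        have "?\<Theta> \<turnstile> ?s v \<gamma>"
          using leibniz[OF s_function_unique[OF f 2 1] _ \<gamma>(1) wt_env_Var 4] has_type_Var[OF is_type_AB(2) w] y by simp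
        with 3 have "?\<Theta> \<turnstile> ?s v (And \<theta> \<gamma>)" by (simp add: And_intro)
        then show "?\<Theta> \<turnstile> ?R" by (rule preimage_intro[OF \<theta>\<gamma> vc 1])
      qed
    qed
  qed
qed

lemma preimage_Or:
  assumes \<theta>: "formula L \<theta>" "var_context L xs y \<theta>" and \<gamma>: "formula L \<gamma>" "var_context L ys y \<gamma>"
    and vc: "var_context L zs y (Or \<theta> \<gamma>)"
  shows "{} \<turnstile> Eq (preimage zs x y f (Or \<theta> \<gamma>)) (Or (preimage xs x y f \<theta>) (preimage ys x y f \<gamma>))"
proof -
  let ?F = "sgraph f" and ?P = "preimage xs x y f \<theta>" and ?Q = "preimage ys x y f \<gamma>"
    and ?R = "preimage zs x y f (Or \<theta> \<gamma>)"
  let ?s = "\<lambda>v. msubst (Var(y := Var v))"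
  have \<theta>\<gamma>: "formula L (Or \<theta> \<gamma>)" using \<theta>(1) \<gamma>(1) by (intro has_type_Or)
  note forms = preimage_formula[OF \<theta>] preimage_formula[OF \<gamma>] preimage_formula[OF \<theta>\<gamma> vc]
  show ?thesis
  proof (rule equivalence)
    show "{?R} \<turnstile> Or ?P ?Q"
    proof (rule preimage_elim[OF \<theta>\<gamma> vc tautology[OF forms(3)]])
      show "formula L (Or ?P ?Q)" using forms by (intro has_type_Or)
      fix v :: "'g var"
      assume v: "snd v = B"
      let ?\<Gamma> = "{Mem (pair (Var x) (Var v)) ?F, ?R}"
      have c: "ctx (insert (?s v \<theta>) ?\<Gamma>)" "ctx (insert (?s v \<gamma>) ?\<Gamma>)"
        using graph_formula[OF v] instance_formula[OF v \<theta>(1)] instance_formula[OF v \<gamma>(1)] forms by simp_all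
      have "insert (?s v \<theta>) ?\<Gamma> \<turnstile> ?P"
        by (rule preimage_intro[OF \<theta>, of _ "Var v"]; rule assumption[OF _ c(1)]; simp)
      moreover have "insert (?s v \<gamma>) ?\<Gamma> \<turnstile> ?Q"
        by (rule preimage_intro[OF \<gamma>, of _ "Var v"]; rule assumption[OF _ c(2)]; simp)
      \<comment> \<open>Substitution commutes with \<open>Or\<close>, so the instance of the
        disjunction at \<open>v\<close> is split into cases, each using the same witness
        \<open>v\<close>.\<close>
      ultimately have "insert (Or (?s v \<theta>) (?s v \<gamma>)) ?\<Gamma> \<turnstile> Or ?P ?Q"
        using forms by (intro Or_left Or_intro) auto
      then show "{Mem (pair (Var x) (Var v)) ?F, ?s v (Or \<theta> \<gamma>), ?R} \<turnstile> Or ?P ?Q"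
        by (simp add: insert_commute)
    qed
    show "{Or ?P ?Q} \<turnstile> ?R"
    proof (rule Or_left)
      show "{?P} \<turnstile> ?R"
      proof (rule preimage_elim[OF \<theta> tautology[OF forms(1)] forms(3)])
        fix v :: "'g var"
        assume v: "snd v = B"
        let ?\<Delta> = "{Mem (pair (Var x) (Var v)) ?F, ?s v \<theta>, ?P}"
        have c: "ctx ?\<Delta>" using graph_formula[OF v] instance_formula[OF v \<theta>(1)] forms by simp
        have 1: "?\<Delta> \<turnstile> Mem (pair (Var x) (Var v)) ?F" and 2: "?\<Delta> \<turnstile> ?s v \<theta>"
          using c by (intro assumption; simp)+
        have "?\<Delta> \<turnstile> ?s v (Or \<theta> \<gamma>)" using 2 instance_formula[OF v \<theta>(1)] instance_formula[OF v \<gamma>(1)] by (simp add: Or_intro)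
        then show "?\<Delta> \<turnstile> ?R" by (rule preimage_intro[OF \<theta>\<gamma> vc 1])
      qed
      show "{?Q} \<turnstile> ?R"
      proof (rule preimage_elim[OF \<gamma> tautology[OF forms(2)] forms(3)])
        fix v :: "'g var"
        assume v: "snd v = B"
        let ?\<Delta> = "{Mem (pair (Var x) (Var v)) ?F, ?s v \<gamma>, ?Q}"
        have c: "ctx ?\<Delta>" using graph_formula[OF v] instance_formula[OF v \<gamma>(1)] forms by simp
        have 1: "?\<Delta> \<turnstile> Mem (pair (Var x) (Var v)) ?F" and 2: "?\<Delta> \<turnstile> ?s v \<gamma>"
          using c by (intro assumption; simp)+
        have "?\<Delta> \<turnstile> ?s v (Or \<theta> \<gamma>)" using 2 instance_formula[OF v \<theta>(1)] instance_formula[OF v \<gamma>(1)] by (simp add: Or_intro)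
        then show "?\<Delta> \<turnstile> ?R" by (rule preimage_intro[OF \<theta>\<gamma> vc 1])
      qed
    qed
  qed
qed

end

end

theorem theorem2p13:
  fixes L :: "('g, 'f) lang"
    and S :: "(('g, 'f) tm set \<times> ('g, 'f) tm) set"
    and A B :: "'g ty"
    and f :: "('g, 'f) sfun"
    and x y :: "'g var"
    and \<theta> \<gamma> :: "('g, 'f) tm"
    and xs\<^sub>\<theta> xs\<^sub>\<gamma> xs\<^sub>1 xs\<^sub>2 :: "'g var list"
  assumes "local_language L"
    and "local_set_theory L S"
    and "nullstellensatz L"
    and "s_function L S A B f"
    and "snd x = A" and "snd y = B"
    and "formula L \<theta>" and "formula L \<gamma>"
    and "var_context L xs\<^sub>\<theta> y \<theta>" and "var_context L xs\<^sub>\<gamma> y \<gamma>"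
    and "var_context L xs\<^sub>1 y (And \<theta> \<gamma>)" and "var_context L xs\<^sub>2 y (Or \<theta> \<gamma>)"
  shows "derives L S {} (Eq (preimage xs\<^sub>1 x y f (And \<theta> \<gamma>))
           (And (preimage xs\<^sub>\<theta> x y f \<theta>) (preimage xs\<^sub>\<gamma> x y f \<gamma>)))
       \<and> derives L S {} (Eq (preimage xs\<^sub>2 x y f (Or \<theta> \<gamma>))
           (Or (preimage xs\<^sub>\<theta> x y f \<theta>) (preimage xs\<^sub>\<gamma> x y f \<gamma>)))"
proof -
  interpret lst L S using assms(1-3) by unfold_locales
  show ?thesis
    using preimage_And[OF assms(4-6)] preimage_Or[OF assms(4-6)] assms(7-12) by blast
qed

end
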